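(* Let $n\geq 4$ and let $A\in\mathbb{C}^{n\times n}$ be a Hermitian matrix, with determinantal polynomial $f=\det(\operatorname{diag}(x_1,\dots,x_n)+A)$. Then one of the following holds: (a) $A$ is irreducible, and every matrix in the fiber of $A$ is diagonally equivalent to an irreducible Hermitian matrix; or (b) $A$ is completely reducible with $s\ge2$ irreducible diagonal blocks, i.e. there is a partition $[n]=T_1\sqcup\dots\sqcup T_s$ into nonempty sets such that $A[T_i,T_j]=0$ for $i\ne j$ and each $A[T_i,T_i]$ is irreducible; and the fiber of $A$ consists exactly of the matrices $B\in\mathbb{C}^{n\times n}$ that, after permuting some rows and the corresponding columns, are block upper triangular with $s$ diagonal blocks which are, in some order, $B[T_1,T_1],\dots,B[T_s,T_s]$, where each $B[T_i,T_i]$ is irreducible, is diagonally equivalent to an irreducible Hermitian matrix, and has determinantal polynomial $\det(\operatorname{diag}(x_k:k\in T_i)+B[T_i,T_i])$ equal to the factor $f_i=\det(\operatorname{diag}(x_k:k\in T_i)+A[T_i,T_i])$ of $f$.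
   Context: $[n]=\{1,\dots,n\}$; $A[S,T]$ is the submatrix of $A$ with rows $S$ and columns $T$. The fiber of $A\in\mathbb{C}^{n\times n}$ (under the principal minor map) is the set of all $B\in\mathbb{C}^{n\times n}$ with $\det B[S,S]=\det A[S,S]$ for all $S\subseteq[n]$. Two complex matrices $A,B$ are diagonally equivalent if there is an invertible complex diagonal matrix $D$ with $A=DBD^{-1}$ or $A=DB^TD^{-1}$. A matrix is reducible if, after permuting some rows and the corresponding columns by the same permutation, it is block upper triangular with at least two (square, nonempty) diagonal blocks; otherwise it is irreducible. A matrix is completely reducible if, after such a permutation, it is block diagonal with irreducible diagonal blocks. *)

theory Defs
  imports
    "HOL-Library.Poly_Mapping"
    "HOL-Library.Disjoint_Sets"
    "HOL-Combinatorics.Permutations"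
    "Jordan_Normal_Form.Determinant"
    "Jordan_Normal_Form.DL_Submatrix"
    "Jordan_Normal_Form.Schur_Decomposition"
begin

(* An n x n matrix has rows and columns indexed by {0..<n}, and A[S,T] is submatrix A S T,
   whose rows and columns appear in increasing order of their indices. *)

definition hermitian_mat :: "complex mat \<Rightarrow> bool" where
  "hermitian_mat A \<longleftrightarrow> square_mat A \<and> mat_adjoint A = A"

(* The determinant of the empty matrix is 1, so S = {} imposes no condition. *)
definition fiber :: "complex mat \<Rightarrow> complex mat set" where
  "fiber A = {B \<in> carrier_mat (dim_row A) (dim_row A).
     \<forall>S \<subseteq> {0..<dim_row A}. det (submatrix B S S) = det (submatrix A S S)}"

definition diag_equiv :: "complex mat \<Rightarrow> complex mat \<Rightarrow> bool" where
  "diag_equiv A B \<longleftrightarrow> (\<exists>m D D'. {A, B, D, D'} \<subseteq> carrier_mat m m \<and> diagonal_mat D \<and>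
     inverts_mat D D' \<and> inverts_mat D' D \<and>
     (A = D * B * D' \<or> A = D * transpose_mat B * D'))"

definition permute_mat :: "(nat \<Rightarrow> nat) \<Rightarrow> 'a mat \<Rightarrow> 'a mat" where
  "permute_mat p A = mat (dim_row A) (dim_col A) (\<lambda>(i, j). A $$ (p i, p j))"

(* The positions occupied by the k-th block when consecutive blocks have sizes ds. *)
definition block_inds :: "nat list \<Rightarrow> nat \<Rightarrow> nat set" where
  "block_inds ds k = {sum_list (take k ds)..<sum_list (take (Suc k) ds)}"

definition block_upper_triangular :: "nat list \<Rightarrow> 'a::zero mat \<Rightarrow> bool" where
  "block_upper_triangular ds A \<longleftrightarrow>
     A \<in> carrier_mat (sum_list ds) (sum_list ds) \<and> (\<forall>d \<in> set ds. d > 0) \<and>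
     (\<forall>k < length ds. \<forall>l < k.
        submatrix A (block_inds ds k) (block_inds ds l) = 0\<^sub>m (ds ! k) (ds ! l))"

definition reducible_mat :: "'a::zero mat \<Rightarrow> bool" where
  "reducible_mat A \<longleftrightarrow> (\<exists>p ds. p permutes {0..<dim_row A} \<and> length ds \<ge> 2 \<and>
     block_upper_triangular ds (permute_mat p A))"

definition irreducible_mat :: "'a::zero mat \<Rightarrow> bool" where
  "irreducible_mat A \<longleftrightarrow> square_mat A \<and> \<not> reducible_mat A"

definition completely_reducible_mat :: "'a::zero mat \<Rightarrow> bool" where
  "completely_reducible_mat A \<longleftrightarrow> (\<exists>p Bs. p permutes {0..<dim_row A} \<and>
     permute_mat p A = diag_block_mat Bs \<and>
     (\<forall>B \<in> set Bs. dim_row B > 0 \<and> irreducible_mat B))"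

(* Polynomials in the variables x_0, x_1, ...: finitely supported maps from exponent vectors
   to coefficients, with the convolution product. *)
type_synonym cpoly = "(nat \<Rightarrow>\<^sub>0 nat) \<Rightarrow>\<^sub>0 complex"

definition Var :: "nat \<Rightarrow> cpoly" where
  "Var k = Poly_Mapping.single (Poly_Mapping.single k 1) 1"

definition Const :: "complex \<Rightarrow> cpoly" where
  "Const c = Poly_Mapping.single 0 c"

definition diag_vars :: "nat set \<Rightarrow> cpoly mat" where
  "diag_vars S = mat (card S) (card S) (\<lambda>(i, j). if i = j then Var (pick S i) else 0)"

(* For M with rows and columns labelled, in increasing order, by S:
   the polynomial det(diag(x_k : k in S) + M). *)
definition det_poly :: "nat set \<Rightarrow> complex mat \<Rightarrow> cpoly" where
  "det_poly S M = det (diag_vars S + map_mat Const M)"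

(* The index set of the k-th diagonal block (and not only the block as a matrix) is required
   to be T (\<pi> k), so that equal blocks at different index sets are not confused. *)
definition block_triangularizable_with ::
    "nat \<Rightarrow> (nat \<Rightarrow> nat set) \<Rightarrow> complex mat \<Rightarrow> bool" where
  "block_triangularizable_with s T B \<longleftrightarrow>
     (\<exists>p \<pi>. p permutes {0..<dim_row B} \<and> \<pi> permutes {0..<s} \<and>
       (let ds = map (\<lambda>k. card (T (\<pi> k))) [0..<s]; C = permute_mat p B in
          block_upper_triangular ds C \<and>
          (\<forall>k < s. p ` block_inds ds k = T (\<pi> k) \<and>
             submatrix C (block_inds ds k) (block_inds ds k)
               = submatrix B (T (\<pi> k)) (T (\<pi> k)))))"

end

theory Submission
  imports Defs
begin

text \<open>
  The proof works with the directed graph that has an arc from \<open>i\<close> to \<open>j\<close> whenever the entry at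
  \<open>(i, j)\<close> is nonzero, and compares this graph for \<open>B\<close> in the fiber with the symmetric graph \<open>G\<close>
  of \<open>A\<close>.  The principal minors of size one and two fix the diagonal of \<open>B\<close> and the products
  \<open>B i j * B j i = \<bar>A i j\<bar>\<^sup>2\<close>.  Larger minors are used only on vertex sets that support a
  chordless cycle: there the Leibniz expansion contains, besides involutions, only the two
  directions of the cycle, so the sum of the two cycle products is determined
  (\<open>cycle_minor\<close>).  Their product is determined as well.  For the Hermitian matrix \<open>A\<close> they are
  complex conjugates \<open>a\<close> and \<open>cnj a\<close>, hence for \<open>B\<close> they are the same two numbers; in
  particular they have equal modulus.

  Splitting a shortest counterexample at a repeated vertex or along a chord extends this to
  \<^emph>\<open>every\<close> closed walk: the products of the entries of \<open>B\<close> along the walk and along its reversal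
  have equal modulus (\<open>closed_balanced\<close>).  This one fact yields everything about \<open>B\<close>:

  \<^item> If an arc of \<open>B\<close> lies on a closed walk of \<open>B\<close>, then the reversed walk has nonzero product
    too, so the arc is an edge of \<open>G\<close> (\<open>arc_returns\<close>).  Hence \<open>B\<close> has no additional arcs inside a
    component of \<open>G\<close>, and the arcs of \<open>B\<close> between different components never close up.
  \<^item> On a connected graph, \<open>\<bar>B i j\<bar> / \<bar>B j i\<bar>\<close> is a quotient of values of a positive
    potential (\<open>potential\<close>).  Conjugation by the square roots of this potential makes the moduli of
    \<open>B\<close> symmetric, and since \<open>B i j * B j i\<close> is real and nonnegative the result is Hermitian
    (\<open>fiber_of_irreducible\<close>).

  When \<open>A\<close> is reducible, the sets \<open>T i\<close> are the components of \<open>G\<close>.  Sorting them by the number of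
  vertices that \<open>B\<close> reaches from them is a topological order, which puts \<open>B\<close> in block triangular form
  (\<open>fiber_triangularizable\<close>).  Conversely, the principal minors of a block triangular matrix are
  products of principal minors of its diagonal blocks (\<open>minor_UNION\<close>), and the latter are the
  coefficients of the determinantal polynomials of the blocks (\<open>minor_pencil_eq_iff\<close>).
\<close>

section \<open>Principal minors as sums over permutations\<close>

text \<open>
  The Leibniz expansion indexed by an arbitrary set of rows and columns.  Working with this instead
  of \<open>det (submatrix M S S)\<close> avoids renumbering the rows whenever \<open>S\<close> is split or reordered.
\<close>
definition minor :: "(nat \<Rightarrow> nat \<Rightarrow> 'a::comm_ring_1) \<Rightarrow> nat set \<Rightarrow> 'a" where
  "minor M S = (\<Sum>p | p permutes S. of_int (sign p) * (\<Prod>i\<in>S. M i (p i)))"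

lemma minor_cong:
  assumes "\<And>i j. i \<in> S \<Longrightarrow> j \<in> S \<Longrightarrow> M i j = N i j"
  shows "minor M S = minor N S"
  unfolding minor_def
  by (intro sum.cong refl arg_cong2[where f = "(*)"] prod.cong) (auto simp: assms permutes_in_image)

lemma minor_reindex:
  assumes g: "bij_betw g S S'" and fin: "finite S"
  shows "minor M S' = minor (\<lambda>i j. M (g i) (g j)) S"
  unfolding minor_def
proof (rule sum.reindex_bij_witness[where j = "map_permutation S' (inv_into S g)" and i = "map_permutation S g"])
  have inj: "inj_on g S" and S': "g ` S = S'" using g by (auto simp: bij_betw_def)
  have g': "bij_betw (inv_into S g) S' S" using g by (rule bij_betw_inv_into)
  fix p assume "p \<in> {p. p permutes S}"
  then have p: "p permutes S" by simp
  show "map_permutation S g p \<in> {p. p permutes S'}"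
    using map_permutation_permutes[OF g p] by simp
  show "map_permutation S' (inv_into S g) (map_permutation S g p) = p"
    by (rule map_permutation_compose_inv[OF g p]) (use inj in auto)
next
  have inj: "inj_on g S" and S': "g ` S = S'" using g by (auto simp: bij_betw_def)
  have g': "bij_betw (inv_into S g) S' S" using g by (rule bij_betw_inv_into)
  have fin': "finite S'" using fin S' by auto
  fix p assume "p \<in> {p. p permutes S'}"
  then have p: "p permutes S'" by simp
  let ?q = "map_permutation S' (inv_into S g) p"
  show q: "?q \<in> {p. p permutes S}"
    using map_permutation_permutes[OF g' p] by simp
  show inv: "map_permutation S g ?q = p"
    by (rule map_permutation_compose_inv[OF g' p]) (use S' in \<open>auto simp: f_inv_into_f\<close>)
  have "sign ?q = sign p"
    by (rule sign_map_permutation) (use p fin' g' in \<open>auto simp: bij_betw_def\<close>)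
  moreover have "(\<Prod>i\<in>S. M (g i) (g (?q i))) = (\<Prod>i\<in>S. M (g i) (p (g i)))"
    by (rule prod.cong) (use map_permutation_apply[OF inj, of _ ?q] inv in auto)
  moreover have "\<dots> = (\<Prod>i\<in>S'. M i (p i))"
    by (rule prod.reindex_bij_betw[OF g])
  ultimately show "of_int (sign ?q) * (\<Prod>i\<in>S. M (g i) (g (?q i))) = of_int (sign p) * (\<Prod>i\<in>S'. M i (p i))"
    by simp
qed

text \<open>
  A permutation with nonzero contribution cannot leave \<open>S'\<close>; by finiteness it then preserves \<open>S'\<close>
  and \<open>S\<close>, so it is a pair of permutations of the two parts.
\<close>
lemma minor_union:
  assumes fin: "finite S" "finite S'" and disj: "S \<inter> S' = {}"
    and zero: "\<And>i j. i \<in> S' \<Longrightarrow> j \<in> S \<Longrightarrow> M i j = 0"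
  shows "minor M (S \<union> S') = minor M S * minor M S'"
proof -
  have dis: "x \<notin> S" if "x \<in> S'" for x using disj that by blast
  let ?t = "\<lambda>S p. of_int (sign p) * (\<Prod>i\<in>S. M i (p i))"
  let ?Q = "{p. p permutes S \<union> S' \<and> p ` S' = S'}"
  have "minor M (S \<union> S') = sum (?t (S \<union> S')) ?Q"
    unfolding minor_def
  proof (rule sum.mono_neutral_right)
    show "finite {p. p permutes S \<union> S'}" using fin by (simp add: finite_permutations)
    show "\<forall>p\<in>{p. p permutes S \<union> S'} - ?Q. ?t (S \<union> S') p = 0"
    proof
      fix p assume "p \<in> {p. p permutes S \<union> S'} - ?Q"
      then have p: "p permutes S \<union> S'" and ne: "p ` S' \<noteq> S'" by auto
      have "\<not> p ` S' \<subseteq> S'"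
        using ne fin by (metis card_image card_subset_eq inj_on_subset p permutes_inj subset_UNIV)
      then obtain i where i: "i \<in> S'" "p i \<notin> S'" by auto
      then have "p i \<in> S" using p permutes_in_image[OF p, of i] by auto
      then have "M i (p i) = 0" using i zero by auto
      then have "(\<Prod>i\<in>S \<union> S'. M i (p i)) = 0" using i fin by (intro prod_zero) auto
      then show "?t (S \<union> S') p = 0" by simp
    qed
  qed auto
  also have "\<dots> = (\<Sum>(p,q)\<in>{p. p permutes S} \<times> {q. q permutes S'}. ?t S p * ?t S' q)"
  proof (rule sym, rule sum.reindex_bij_witness[where j = "\<lambda>(p,q). p \<circ> q"
        and i = "\<lambda>r. (restrict_id r S, restrict_id r S')"], goal_cases)
    case (1 pq)
    then obtain p q where pq: "pq = (p, q)" "p permutes S" "q permutes S'" by auto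
    have "restrict_id (p \<circ> q) S x = p x" for x
      using permutes_not_in[OF pq(2), of x] permutes_not_in[OF pq(3), of x] disj
      by (cases "x \<in> S"; cases "x \<in> S'") auto
    moreover have "restrict_id (p \<circ> q) S' x = q x" for x
      using permutes_not_in[OF pq(2), of "q x"] permutes_not_in[OF pq(3), of x] disj
         permutes_in_image[OF pq(3), of x]
      by (cases "x \<in> S'") auto
    ultimately show ?case unfolding pq by auto
  next
    case (2 pq)
    then obtain p q where pq: "pq = (p, q)" "p permutes S" "q permutes S'" by auto
    have "p permutes S \<union> S'" "q permutes S \<union> S'" using pq by (auto intro: permutes_subset)
    then have 1: "p \<circ> q permutes S \<union> S'" using permutes_compose by blast
    have "(p \<circ> q) ` S' = q ` S'"
    proof (rule image_cong)
      fix x assume "x \<in> S'"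
      then have "q x \<in> S'" using permutes_in_image[OF pq(3)] by simp
      then show "(p \<circ> q) x = q x" using permutes_not_in[OF pq(2), of "q x"] dis by auto
    qed simp
    then show ?case using 1 permutes_image[OF pq(3)] by (simp add: pq)
  next
    case (3 r)
    then have r: "r permutes S \<union> S'" "r ` S' = S'" by auto
    have S': "r x \<in> S'" if "x \<in> S'" for x using r(2) that by auto
    then have nS: "r x \<notin> S" if "x \<in> S'" for x using that disj by blast
    have "(restrict_id r S \<circ> restrict_id r S') x = r x" for x
      using permutes_not_in[OF r(1), of x] disj nS[of x]
      by (cases "x \<in> S'"; cases "x \<in> S") auto
    then show ?case by auto
  next
    case (4 r)
    then have r: "r permutes S \<union> S'" "r ` S' = S'" by auto
    have inj: "inj r" using permutes_inj[OF r(1)] .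
    have "r ` (S \<union> S') = S \<union> S'" using permutes_image[OF r(1)] .
    moreover have "r ` S \<inter> r ` S' = {}" using disj inj by (metis image_Int image_empty)
    ultimately have "r ` S = S" using r(2) disj by (auto simp: image_Un)
    then have "bij_betw r S S" "bij_betw r S' S'" using r(2) inj
      by (auto simp: bij_betw_def intro: inj_on_subset)
    then show ?case by (auto intro: permutes_restrict_id)
  next
    case (5 pq)
    then obtain p q where pq: "pq = (p, q)" "p permutes S" "q permutes S'" by auto
    have "sign (p \<circ> q) = sign p * sign q"
      using pq fin by (intro sign_compose) (auto intro: permutes_imp_permutation)
    moreover have "(\<Prod>i\<in>S. M i ((p \<circ> q) i)) = (\<Prod>i\<in>S. M i (p i))"
    proof (rule prod.cong)
      fix x assume "x \<in> S"
      then have "q x = x" using permutes_not_in[OF pq(3), of x] disj by auto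
      then show "M x ((p \<circ> q) x) = M x (p x)" by simp
    qed simp
    moreover have "(\<Prod>i\<in>S'. M i ((p \<circ> q) i)) = (\<Prod>i\<in>S'. M i (q i))"
    proof (rule prod.cong)
      fix x assume "x \<in> S'"
      then have "q x \<in> S'" using permutes_in_image[OF pq(3)] by simp
      then show "M x ((p \<circ> q) x) = M x (q x)" using permutes_not_in[OF pq(2), of "q x"] dis by auto
    qed simp
    ultimately show ?case unfolding pq
      using fin disj by (simp add: prod.union_disjoint mult_ac)
  qed
  also have "\<dots> = minor M S * minor M S'"
    unfolding minor_def sum_product sum.cartesian_product by simp
  finally show ?thesis .
qed

lemma minor_UNION:
  fixes s :: nat
  assumes "\<And>k. k < s \<Longrightarrow> finite (T k)" "disjoint_family_on T {..<s}"
    and "\<And>k l i j. k < s \<Longrightarrow> l < k \<Longrightarrow> i \<in> T k \<Longrightarrow> j \<in> T l \<Longrightarrow> M i j = 0"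
  shows "minor M (\<Union>k<s. T k) = (\<Prod>k<s. minor M (T k))"
proof -
  have "m \<le> s \<Longrightarrow> minor M (\<Union>k<m. T k) = (\<Prod>k<m. minor M (T k))" for m
  proof (induction m)
    case 0
    then show ?case by (simp add: minor_def)
  next
    case (Suc m)
    have "minor M ((\<Union>k<m. T k) \<union> T m) = minor M (\<Union>k<m. T k) * minor M (T m)"
    proof (rule minor_union)
      show "(\<Union>k<m. T k) \<inter> T m = {}"
      proof (rule equals0I, elim IntE UN_E)
        fix x l assume "l \<in> {..<m}" "x \<in> T l" "x \<in> T m"
        then show False using disjoint_family_onD[OF assms(2), of l m] Suc.prems by auto
      qed
      fix i j assume i: "i \<in> T m" and "j \<in> (\<Union>k<m. T k)"
      then obtain l where "l < m" "j \<in> T l" by auto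
      then show "M i j = 0" using assms(3)[of m l i j] i Suc.prems by simp
    next
      show "finite (\<Union>k<m. T k)" "finite (T m)" using assms(1) Suc.prems by auto
    qed
    moreover have "(\<Union>k<m. T k) \<union> T m = (\<Union>k<Suc m. T k)" by (auto simp: less_Suc_eq)
    ultimately show ?case using Suc by simp
  qed
  then show ?thesis by simp
qed

abbreviation (input) entries :: "'a mat \<Rightarrow> nat \<Rightarrow> nat \<Rightarrow> 'a" where
  "entries M i j \<equiv> M $$ (i, j)"

lemma det_minor: "M \<in> carrier_mat n n \<Longrightarrow> det M = minor (entries M) {0..<n}"
  by (simp add: det_def' minor_def)

lemma bij_betw_pick:
  assumes "finite S"
  shows "bij_betw (pick S) {0..<card S} S"
proof -
  have "inj_on (pick S) {0..<card S}"
    by (rule linorder_inj_onI) (use pick_mono_le in \<open>force+\<close>)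
  moreover have "pick S ` {0..<card S} \<subseteq> S" using pick_in_set_le by auto
  ultimately show ?thesis
    by (metis assms bij_betw_def card_atLeastLessThan card_image card_subset_eq diff_zero)
qed

lemma submatrix_carrier:
  assumes "M \<in> carrier_mat n n" "I \<subseteq> {0..<n}" "J \<subseteq> {0..<n}"
  shows "submatrix M I J \<in> carrier_mat (card I) (card J)"
    and "i < card I \<Longrightarrow> j < card J \<Longrightarrow> submatrix M I J $$ (i, j) = M $$ (pick I i, pick J j)"
proof -
  have "{i. i < n \<and> i \<in> I} = I" "{i. i < n \<and> i \<in> J} = J" using assms by auto
  then show "submatrix M I J \<in> carrier_mat (card I) (card J)"
    and "i < card I \<Longrightarrow> j < card J \<Longrightarrow> submatrix M I J $$ (i, j) = M $$ (pick I i, pick J j)"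
    using assms(1) by (auto simp: submatrix_def)
qed

lemma minor_submatrix:
  assumes M: "M \<in> carrier_mat n n" and T: "T \<subseteq> {0..<n}" and S: "S \<subseteq> {0..<card T}"
  shows "minor (entries (submatrix M T T)) S = minor (entries M) (pick T ` S)"
proof -
  have fin: "finite T" using T finite_subset by blast
  have "bij_betw (pick T) S (pick T ` S)"
    using bij_betw_pick[OF fin] S by (auto simp: bij_betw_def intro: inj_on_subset)
  then have "minor (entries M) (pick T ` S) = minor (\<lambda>i j. entries M (pick T i) (pick T j)) S"
    by (rule minor_reindex) (use S finite_subset in blast)
  also have "\<dots> = minor (entries (submatrix M T T)) S"
    by (rule minor_cong) (use S in \<open>auto simp: submatrix_carrier(2)[OF M T T] subset_iff\<close>)
  finally show ?thesis by simp
qed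

lemma det_submatrix:
  assumes M: "M \<in> carrier_mat n n" and T: "T \<subseteq> {0..<n}"
  shows "det (submatrix M T T) = minor (entries M) T"
proof -
  have "det (submatrix M T T) = minor (entries (submatrix M T T)) {0..<card T}"
    by (rule det_minor[OF submatrix_carrier(1)[OF M T T]])
  also have "\<dots> = minor (entries M) (pick T ` {0..<card T})"
    by (rule minor_submatrix[OF M T]) simp
  also have "pick T ` {0..<card T} = T"
    using bij_betw_pick[of T] T finite_subset by (auto simp: bij_betw_def)
  finally show ?thesis .
qed

lemma fiber_iff:
  assumes "A \<in> carrier_mat n n"
  shows "B \<in> fiber A \<longleftrightarrow> B \<in> carrier_mat n n \<and> (\<forall>S\<subseteq>{0..<n}. minor (entries B) S = minor (entries A) S)"
  using assms by (auto simp: fiber_def det_submatrix)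

lemma fiber_submatrix:
  assumes A: "A \<in> carrier_mat n n" and B: "B \<in> carrier_mat n n" and T: "T \<subseteq> {0..<n}"
  shows "submatrix B T T \<in> fiber (submatrix A T T) \<longleftrightarrow>
    (\<forall>S\<subseteq>T. minor (entries B) S = minor (entries A) S)"
proof -
  have b: "pick T ` {0..<card T} = T"
    using bij_betw_pick[of T] T finite_subset by (auto simp: bij_betw_def)
  have "submatrix B T T \<in> fiber (submatrix A T T) \<longleftrightarrow>
    (\<forall>S\<subseteq>{0..<card T}. minor (entries B) (pick T ` S) = minor (entries A) (pick T ` S))"
    using minor_submatrix[OF A T] minor_submatrix[OF B T] submatrix_carrier(1)[OF B T T]
    by (simp add: fiber_iff[OF submatrix_carrier(1)[OF A T T]])
  also have "\<dots> \<longleftrightarrow> (\<forall>S\<subseteq>pick T ` {0..<card T}. minor (entries B) S = minor (entries A) S)"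
    by (simp only: all_subset_image)
  finally show ?thesis unfolding b .
qed

section \<open>Coefficients of determinantal polynomials\<close>

lemma Const_hom: "Const 0 = 0" "Const 1 = 1" "Const (a + b) = Const a + Const b"
  "Const (a * b) = Const a * Const b" "Const (- a) = - Const a"
  by (simp_all add: Const_def single_add mult_single single_uminus)

lemma Const_sum: "Const (sum f S) = (\<Sum>x\<in>S. Const (f x))"
  by (induction S rule: infinite_finite_induct) (auto simp: Const_hom)

lemma Const_prod: "Const (prod f S) = (\<Prod>x\<in>S. Const (f x))"
  by (induction S rule: infinite_finite_induct) (auto simp: Const_hom)

lemma Const_sign: "Const (of_int (sign p)) = of_int (sign p)"
  by (simp add: sign_def Const_hom)

text \<open>
  The entries of the matrix \<open>diag(x) + M\<close>, with rows and columns labelled by all natural numbers.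
\<close>
definition pencil :: "complex mat \<Rightarrow> nat \<Rightarrow> nat \<Rightarrow> cpoly" where
  "pencil M i j = (if i = j then Var i else 0) + Const (M $$ (i, j))"

lemma det_poly_minor:
  assumes M: "M \<in> carrier_mat n n" and T: "T \<subseteq> {0..<n}"
  shows "det_poly T (submatrix M T T) = minor (pencil M) T"
proof -
  have fin: "finite T" using T finite_subset by blast
  note b = bij_betw_pick[OF fin]
  note c = submatrix_carrier[OF M T T]
  have inj: "pick T i = pick T j \<longleftrightarrow> i = j" if "i < card T" "j < card T" for i j
    using b that by (auto simp: bij_betw_def inj_on_def)
  have "det_poly T (submatrix M T T)
      = minor (entries (diag_vars T + map_mat Const (submatrix M T T))) {0..<card T}"
    unfolding det_poly_def by (rule det_minor) (use c(1) in \<open>auto simp: diag_vars_def\<close>)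
  also have "\<dots> = minor (\<lambda>i j. pencil M (pick T i) (pick T j)) {0..<card T}"
    by (rule minor_cong) (use c inj in \<open>auto simp: diag_vars_def pencil_def\<close>)
  also have "\<dots> = minor (pencil M) T"
    by (rule minor_reindex[OF b, symmetric]) simp
  finally show ?thesis .
qed

definition squarefree_monom :: "nat set \<Rightarrow> nat \<Rightarrow>\<^sub>0 nat" where
  "squarefree_monom U = (\<Sum>i\<in>U. Poly_Mapping.single i 1)"

lemma prod_Var: "prod Var U = Poly_Mapping.single (squarefree_monom U) 1"
  by (induction U rule: infinite_finite_induct) (auto simp: squarefree_monom_def Var_def mult_single)

lemma squarefree_monom_eq_iff:
  assumes "finite U" "finite U'"
  shows "squarefree_monom U = squarefree_monom U' \<longleftrightarrow> U = U'"
proof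
  have *: "Poly_Mapping.lookup (squarefree_monom U) k = (if k \<in> U then 1 else 0)" if "finite U" for U k
    using that by (simp add: squarefree_monom_def lookup_sum lookup_single when_def)
  assume "squarefree_monom U = squarefree_monom U'"
  then have "Poly_Mapping.lookup (squarefree_monom U) k = Poly_Mapping.lookup (squarefree_monom U') k" for k by simp
  then show "U = U'" unfolding *[OF assms(1)] *[OF assms(2)] by (metis one_neq_zero subsetI subset_antisym)
qed simp

text \<open>
  Expand each diagonal entry \<open>x\<^sub>i + M i i\<close>: choosing the variables with index in \<open>U\<close> forces the
  permutation to fix \<open>U\<close> pointwise, which leaves the principal minor on the complement of \<open>U\<close>.
\<close>
lemma minor_pencil:
  assumes fin: "finite T"
  shows "minor (pencil M) T = (\<Sum>U\<in>Pow T. Poly_Mapping.single (squarefree_monom U) (minor (entries M) (T - U)))"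
proof -
  let ?d = "\<lambda>p i. if i = p i then Var i else (0::cpoly)"
  have exp: "(\<Prod>i\<in>T. pencil M i (p i)) =
      (\<Sum>U\<in>Pow T. (\<Prod>i\<in>U. ?d p i) * Const (\<Prod>i\<in>T-U. entries M i (p i)))" for p
    unfolding pencil_def Const_prod by (rule prod_add[OF fin])
  have "minor (pencil M) T = (\<Sum>p | p permutes T. \<Sum>U\<in>Pow T.
      of_int (sign p) * ((\<Prod>i\<in>U. ?d p i) * Const (\<Prod>i\<in>T-U. entries M i (p i))))"
    unfolding minor_def exp by (simp add: sum_distrib_left)
  also have "\<dots> = (\<Sum>U\<in>Pow T. \<Sum>p | p permutes T.
      of_int (sign p) * ((\<Prod>i\<in>U. ?d p i) * Const (\<Prod>i\<in>T-U. entries M i (p i))))"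
    by (rule sum.swap)
  also have "\<dots> = (\<Sum>U\<in>Pow T. prod Var U * Const (minor (entries M) (T - U)))"
  proof (rule sum.cong[OF refl])
    fix U assume "U \<in> Pow T"
    then have U: "U \<subseteq> T" by auto
    then have finU: "finite U" using fin finite_subset by blast
    have "(\<Sum>p | p permutes T. of_int (sign p) * ((\<Prod>i\<in>U. ?d p i) * Const (\<Prod>i\<in>T-U. entries M i (p i))))
      = (\<Sum>p | p permutes (T - U). of_int (sign p) * ((\<Prod>i\<in>U. ?d p i) * Const (\<Prod>i\<in>T-U. entries M i (p i))))"
    proof (rule sum.mono_neutral_right)
      show "finite {p. p permutes T}" using fin by (simp add: finite_permutations)
      show "{p. p permutes (T - U)} \<subseteq> {p. p permutes T}" by (auto intro: permutes_subset)
      show "\<forall>p\<in>{p. p permutes T} - {p. p permutes (T - U)}.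
         of_int (sign p) * ((\<Prod>i\<in>U. ?d p i) * Const (\<Prod>i\<in>T-U. entries M i (p i))) = 0"
      proof
        fix p assume "p \<in> {p. p permutes T} - {p. p permutes (T - U)}"
        then have p: "p permutes T" "\<not> p permutes (T - U)" by auto
        then obtain i where "i \<in> U" "p i \<noteq> i"
          using permutes_superset[OF p(1), of "T - U"] by blast
        then have "(\<Prod>i\<in>U. ?d p i) = 0" using finU by (intro prod_zero bexI[of _ i]) auto
        then show "of_int (sign p) * ((\<Prod>i\<in>U. ?d p i) * Const (\<Prod>i\<in>T-U. entries M i (p i))) = 0"
          by simp
      qed
    qed
    also have "\<dots> = (\<Sum>p | p permutes (T - U). prod Var U * Const (of_int (sign p) * (\<Prod>i\<in>T-U. entries M i (p i))))"
    proof (rule sum.cong[OF refl])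
      fix p assume "p \<in> {p. p permutes (T - U)}"
      then have "(\<Prod>i\<in>U. ?d p i) = prod Var U"
        by (intro prod.cong) (auto simp: permutes_not_in)
      then show "of_int (sign p) * ((\<Prod>i\<in>U. ?d p i) * Const (\<Prod>i\<in>T-U. entries M i (p i)))
         = prod Var U * Const (of_int (sign p) * (\<Prod>i\<in>T-U. entries M i (p i)))"
        by (simp add: Const_hom Const_sign mult_ac)
    qed
    also have "\<dots> = prod Var U * Const (minor (entries M) (T - U))"
      unfolding minor_def by (simp add: sum_distrib_left Const_sum)
    finally show "(\<Sum>p | p permutes T. of_int (sign p) * ((\<Prod>i\<in>U. ?d p i) * Const (\<Prod>i\<in>T-U. entries M i (p i))))
      = prod Var U * Const (minor (entries M) (T - U))" .
  qed
  finally show ?thesis by (simp add: prod_Var Const_def mult_single)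
qed

text \<open>
  Distinct sets \<open>U\<close> give distinct monomials, so a determinantal polynomial carries the same
  information as the list of all principal minors.
\<close>
lemma minor_pencil_eq_iff:
  assumes fin: "finite T"
  shows "minor (pencil M) T = minor (pencil N) T \<longleftrightarrow> (\<forall>S\<subseteq>T. minor (entries M) S = minor (entries N) S)"
proof
  have coeff: "Poly_Mapping.lookup (minor (pencil M) T) (squarefree_monom (T - S)) = minor (entries M) S" if "S \<subseteq> T" for S M
  proof -
    have "Poly_Mapping.lookup (minor (pencil M) T) (squarefree_monom (T - S))
        = (\<Sum>U\<in>Pow T. if U = T - S then minor (entries M) (T - U) else 0)"
      unfolding minor_pencil[OF fin] lookup_sum lookup_single
      by (rule sum.cong[OF refl])
         (use fin in \<open>auto simp: when_def squarefree_monom_eq_iff finite_subset\<close>)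
    also have "\<dots> = minor (entries M) (T - (T - S))" using fin by simp
    also have "T - (T - S) = S" using that by auto
    finally show ?thesis .
  qed
  assume "minor (pencil M) T = minor (pencil N) T"
  then show "\<forall>S\<subseteq>T. minor (entries M) S = minor (entries N) S" using coeff by metis
next
  assume "\<forall>S\<subseteq>T. minor (entries M) S = minor (entries N) S"
  then show "minor (pencil M) T = minor (pencil N) T"
    unfolding minor_pencil[OF fin] by (intro sum.cong) auto
qed

section \<open>Principal minors on a chordless cycle\<close>

text \<open>
  Along an involution the entries occur singly on the diagonal or in pairs \<open>M i j * M j i\<close>.
\<close>
lemma involution_prod:
  fixes p :: "nat \<Rightarrow> nat" and A B :: "nat \<Rightarrow> nat \<Rightarrow> 'a::comm_ring_1"
  assumes p: "p permutes S" and fin: "finite S" and inv: "\<And>i. p (p i) = i"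
    and diag: "\<And>i. i \<in> S \<Longrightarrow> A i i = B i i"
    and prods: "\<And>i j. i \<in> S \<Longrightarrow> j \<in> S \<Longrightarrow> A i j * A j i = B i j * B j i"
  shows "(\<Prod>i\<in>S. A i (p i)) = (\<Prod>i\<in>S. B i (p i))"
proof -
  let ?F = "{i\<in>S. p i = i}" and ?L = "{i\<in>S. i < p i}" and ?G = "{i\<in>S. p i < i}"
  have pS: "p i \<in> S \<longleftrightarrow> i \<in> S" for i using permutes_in_image[OF p] .
  have *: "(\<Prod>i\<in>S. M i (p i)) = (\<Prod>i\<in>?F. M i i) * (\<Prod>i\<in>?L. M i (p i) * M (p i) i)"
    for M :: "nat \<Rightarrow> nat \<Rightarrow> 'a"
  proof -
    have "S = ?F \<union> (?L \<union> ?G)" by auto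
    then have "(\<Prod>i\<in>S. M i (p i)) = (\<Prod>i\<in>?F \<union> (?L \<union> ?G). M i (p i))" by simp
    also have "\<dots> = (\<Prod>i\<in>?F. M i (p i)) * ((\<Prod>i\<in>?L. M i (p i)) * (\<Prod>i\<in>?G. M i (p i)))"
      using fin by (subst prod.union_disjoint; (subst prod.union_disjoint)?) auto
    also have "(\<Prod>i\<in>?G. M i (p i)) = (\<Prod>i\<in>?L. M (p i) i)"
      by (rule prod.reindex_bij_witness[where i = p and j = p]) (auto simp: inv pS)
    finally show ?thesis by (simp add: prod.distrib)
  qed
  have "(\<Prod>i\<in>?F. A i i) = (\<Prod>i\<in>?F. B i i)" by (rule prod.cong) (auto simp: diag)
  moreover have "(\<Prod>i\<in>?L. A i (p i) * A (p i) i) = (\<Prod>i\<in>?L. B i (p i) * B (p i) i)"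
    by (rule prod.cong) (auto simp: prods pS)
  ultimately show ?thesis unfolding * by simp
qed

text \<open>
  The cyclic successor on \<open>{0..<k}\<close>, extended by the identity so that it is a permutation in the sense
  of \<open>permutes\<close>; \<open>rot'\<close> is its inverse.  Case distinctions are easier to use here than \<open>mod\<close>.
\<close>
definition rot :: "nat \<Rightarrow> nat \<Rightarrow> nat" where
  "rot k i = (if Suc i < k then Suc i else if Suc i = k then 0 else i)"

definition rot' :: "nat \<Rightarrow> nat \<Rightarrow> nat" where
  "rot' k i = (if i < k then (if i = 0 then k - 1 else i - 1) else i)"

lemma rot_rot': "rot k (rot' k i) = i" "rot' k (rot k i) = i"
  by (auto simp: rot_def rot'_def)

lemma rot_less: "rot k i < k \<longleftrightarrow> i < k" "rot' k i < k \<longleftrightarrow> i < k"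
  by (auto simp: rot_def rot'_def)

lemma rot_permutes: "rot k permutes {0..<k}"
proof (rule bij_imp_permutes)
  show "bij_betw (rot k) {0..<k} {0..<k}"
    by (rule bij_betw_byWitness[where f' = "rot' k"]) (auto simp: rot_rot' rot_less)
qed (auto simp: rot_def)

lemma inv_rot: "Hilbert_Choice.inv (rot k) = rot' k"
  by (rule inv_unique_comp) (auto simp: rot_rot' fun_eq_iff)

lemma rot_neq: 
  assumes "3 \<le> k" "i < k" shows "rot k i \<noteq> i" "rot k (rot k i) \<noteq> i"
  using assms by (auto simp: rot_def split: if_splits)

lemma rot_closed:
  assumes "i < k" "P i" "\<And>j. j < k \<Longrightarrow> P j \<Longrightarrow> P (rot k j)" "j < k"
  shows "P j"
proof -
  have up: "P m" if "l \<le> m" "m < k" "P l" for l m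
    using that(1,2)
  proof (induction m rule: dec_induct)
    case base show ?case by fact
  next
    case (step m)
    then show ?case using assms(3)[of m] by (auto simp: rot_def)
  qed
  have "P (k - 1)" using up[of i "k - 1"] assms(1,2) by auto
  then have "P 0" using assms(3)[of "k - 1"] assms(1) by (auto simp: rot_def)
  then show ?thesis using up[of 0 j] assms(4) by auto
qed

text \<open>
  Once the permutation moves \<open>i\<close> forward and does not come straight back, injectivity leaves the next
  vertex no choice but to move forward as well.  The condition \<open>p (rot k i) \<noteq> i\<close> is carried along
  because \<open>k \<ge> 3\<close>.
\<close>
lemma cycle_perm_eq_rot:
  assumes k: "3 \<le> k" and p: "p permutes {0..<k}"
    and step: "\<And>i. i < k \<Longrightarrow> p i = i \<or> p i = rot k i \<or> i = rot k (p i)"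
    and i: "i < k" "p i = rot k i" "p (rot k i) \<noteq> i"
  shows "p = rot k"
proof
  have inj: "p x = p y \<longleftrightarrow> x = y" for x y using permutes_inj[OF p] by (auto dest: injD)
  fix j
  show "p j = rot k j"
  proof (cases "j < k")
    case True
    have "p j = rot k j \<and> p (rot k j) \<noteq> j"
    proof (rule rot_closed[OF i(1) _ _ True])
      show "p i = rot k i \<and> p (rot k i) \<noteq> i" using i by simp
      fix j assume j: "j < k" and Q: "p j = rot k j \<and> p (rot k j) \<noteq> j"
      have "p (rot k j) \<noteq> rot k j" using Q rot_neq[OF k j] inj[of j "rot k j"] by metis
      moreover have "rot k j \<noteq> rot k (p (rot k j))" using Q by (metis rot_rot'(2))
      ultimately have 1: "p (rot k j) = rot k (rot k j)"
        using step[of "rot k j"] j by (auto simp: rot_less)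
      have "p (rot k (rot k j)) \<noteq> rot k j"
        using Q rot_neq[OF k j] inj[of j "rot k (rot k j)"] by metis
      with 1 show "p (rot k j) = rot k (rot k j) \<and> p (rot k (rot k j)) \<noteq> rot k j" by simp
    qed
    then show ?thesis by simp
  next
    case False
    then show ?thesis using permutes_not_in[OF p, of j] by (auto simp: rot_def)
  qed
qed

text \<open>
  A permutation along the edges of a cycle that is not an involution is a rotation by one step: a
  step backwards of \<open>p\<close> is a step forwards of its inverse.
\<close>
lemma cycle_perm_cases:
  assumes k: "3 \<le> k" and p: "p permutes {0..<k}"
    and step: "\<And>i. i < k \<Longrightarrow> p i = i \<or> p i = rot k i \<or> i = rot k (p i)"
    and ninv: "p (p i) \<noteq> i"
  shows "p = rot k \<or> p = Hilbert_Choice.inv (rot k)"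
proof -
  have i: "i < k" using ninv permutes_not_in[OF p, of i] by (cases "i < k") auto
  consider "p i = rot k i" | "i = rot k (p i)" using step[OF i] ninv by metis
  then show ?thesis
  proof cases
    case 1
    then show ?thesis using cycle_perm_eq_rot[OF k p step i] ninv by auto
  next
    case 2
    let ?q = "Hilbert_Choice.inv p"
    have pq: "p (?q x) = x" "?q (p x) = x" for x using permutes_inverses[OF p] by auto
    have q: "?q permutes {0..<k}" by (rule permutes_inv[OF p])
    have "?q = rot k"
    proof (rule cycle_perm_eq_rot[OF k q])
      fix j assume "j < k"
      then have "?q j < k" using permutes_in_image[OF q, of j] by simp
      from step[OF this] show "?q j = j \<or> ?q j = rot k j \<or> j = rot k (?q j)"
        by (auto simp: pq)
    next
      show "p i < k" using permutes_in_image[OF p, of i] i by simp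
      show "?q (p i) = rot k (p i)" using 2 pq by simp
      show "?q (rot k (p i)) \<noteq> p i" using 2 ninv pq by metis
    qed
    then show ?thesis using inv_inv_eq[OF permutes_bij[OF p]] by auto
  qed
qed

definition cycle_prod :: "nat \<Rightarrow> (nat \<Rightarrow> nat \<Rightarrow> 'a::comm_ring_1) \<Rightarrow> 'a" where
  "cycle_prod k M = (\<Prod>i<k. M i (rot k i))"

definition reverse_cycle_prod :: "nat \<Rightarrow> (nat \<Rightarrow> nat \<Rightarrow> 'a::comm_ring_1) \<Rightarrow> 'a" where
  "reverse_cycle_prod k M = (\<Prod>i<k. M (rot k i) i)"

text \<open>
  The two rotations contribute the two directed cycle products with the same sign; all remaining
  nonzero terms come from involutions and agree for \<open>A\<close> and \<open>B\<close>.
\<close>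
lemma cycle_minor:
  fixes A B :: "nat \<Rightarrow> nat \<Rightarrow> 'a::comm_ring_1"
  assumes k: "3 \<le> k"
    and zeroA: "\<And>i j. i < k \<Longrightarrow> j < k \<Longrightarrow> i \<noteq> j \<Longrightarrow> j \<noteq> rot k i \<Longrightarrow> i \<noteq> rot k j \<Longrightarrow> A i j = 0"
    and zeroB: "\<And>i j. i < k \<Longrightarrow> j < k \<Longrightarrow> i \<noteq> j \<Longrightarrow> j \<noteq> rot k i \<Longrightarrow> i \<noteq> rot k j \<Longrightarrow> B i j = 0"
    and diag: "\<And>i. i < k \<Longrightarrow> A i i = B i i"
    and prods: "\<And>i j. i < k \<Longrightarrow> j < k \<Longrightarrow> A i j * A j i = B i j * B j i"
    and minor: "minor A {0..<k} = minor B {0..<k}"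
  shows "cycle_prod k A + reverse_cycle_prod k A = cycle_prod k B + reverse_cycle_prod k B"
proof -
  let ?t = "\<lambda>M p. of_int (sign p) * (\<Prod>i\<in>{0..<k}. M i (p i)) :: 'a"
  let ?P = "{p. p permutes {0..<k}}" and ?I = "{p. p permutes {0..<k} \<and> (\<forall>i. p (p i) = i)}"
  let ?s = "of_int (sign (rot k)) :: 'a"
  have fin: "finite ?P" by (simp add: finite_permutations)
  have rot0: "rot k (rot k 0) \<noteq> 0" using rot_neq[OF k, of 0] k by auto
  have *: "minor M {0..<k} = sum (?t M) ?I + ?s * (cycle_prod k M + reverse_cycle_prod k M)"
    if zero: "\<And>i j. i < k \<Longrightarrow> j < k \<Longrightarrow> i \<noteq> j \<Longrightarrow> j \<noteq> rot k i \<Longrightarrow> i \<noteq> rot k j \<Longrightarrow> M i j = 0"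
    for M :: "nat \<Rightarrow> nat \<Rightarrow> 'a"
  proof -
    have "minor M {0..<k} = sum (?t M) ?I + sum (?t M) (?P - ?I)"
      unfolding minor_def using sum.subset_diff[of ?I ?P "?t M"] fin
      by (simp add: Collect_mono add.commute)
    also have "sum (?t M) (?P - ?I) = sum (?t M) {rot k, Hilbert_Choice.inv (rot k)}"
    proof (rule sum.mono_neutral_right)
      have "Hilbert_Choice.inv (rot k) (Hilbert_Choice.inv (rot k) (rot k (rot k 0))) = 0" by (simp add: inv_rot rot_rot')
      then have "\<not> (\<forall>i. Hilbert_Choice.inv (rot k) (Hilbert_Choice.inv (rot k) i) = i)" using rot0 by metis
      moreover have "\<not> (\<forall>i. rot k (rot k i) = i)" using rot0 by metis
      moreover have "rot k \<in> ?P" "Hilbert_Choice.inv (rot k) \<in> ?P"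
        using rot_permutes[of k] permutes_inv[OF rot_permutes[of k]] by blast+
      ultimately show "{rot k, Hilbert_Choice.inv (rot k)} \<subseteq> ?P - ?I" by blast
      show "\<forall>p\<in>?P - ?I - {rot k, Hilbert_Choice.inv (rot k)}. ?t M p = 0"
      proof
        fix p assume "p \<in> ?P - ?I - {rot k, Hilbert_Choice.inv (rot k)}"
        then obtain i where p: "p permutes {0..<k}" "p (p i) \<noteq> i" "p \<noteq> rot k" "p \<noteq> Hilbert_Choice.inv (rot k)"
          by blast
        then obtain j where j: "j < k" "\<not> (p j = j \<or> p j = rot k j \<or> j = rot k (p j))"
          using cycle_perm_cases[OF k p(1) _ p(2)] by blast
        moreover have "p j < k" using j(1) permutes_in_image[OF p(1), of j] by simp
        ultimately have "M j (p j) = 0" using zero[of j "p j"] by metis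
        then have "(\<Prod>i\<in>{0..<k}. M i (p i)) = 0"
          using j(1) by (intro prod_zero bexI[of _ j]) auto
        then show "?t M p = 0" by simp
      qed
    next
      show "finite (?P - ?I)" using fin by (rule finite_Diff)
    qed
    also have "\<dots> = ?t M (rot k) + ?t M (Hilbert_Choice.inv (rot k))"
    proof -
      have "rot k (rot k 0) \<noteq> Hilbert_Choice.inv (rot k) (rot k 0)" using rot0 by (simp add: inv_rot rot_rot')
      then have "rot k \<noteq> Hilbert_Choice.inv (rot k)" by metis
      then show ?thesis by simp
    qed
    also have "sign (Hilbert_Choice.inv (rot k)) = sign (rot k)"
      using permutes_imp_permutation[OF _ rot_permutes[of k]] by (simp add: sign_inverse)
    also have "(\<Prod>i\<in>{0..<k}. M i (Hilbert_Choice.inv (rot k) i)) = reverse_cycle_prod k M"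
      unfolding reverse_cycle_prod_def
      by (rule prod.reindex_bij_witness[where i = "rot k" and j = "Hilbert_Choice.inv (rot k)"])
         (auto simp: inv_rot rot_rot' rot_less)
    also have "(\<Prod>i\<in>{0..<k}. M i (rot k i)) = cycle_prod k M" unfolding cycle_prod_def
      by (simp add: atLeast0LessThan)
    finally show ?thesis by (simp add: algebra_simps)
  qed
  have "sum (?t A) ?I = sum (?t B) ?I"
  proof (rule sum.cong[OF refl])
    fix p assume "p \<in> ?I"
    then have "(\<Prod>i\<in>{0..<k}. A i (p i)) = (\<Prod>i\<in>{0..<k}. B i (p i))"
      by (intro involution_prod) (simp_all add: diag prods)
    then show "?t A p = ?t B p" by simp
  qed
  then have eq: "?s * (cycle_prod k A + reverse_cycle_prod k A) = ?s * (cycle_prod k B + reverse_cycle_prod k B)"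
    using *[OF zeroA] *[OF zeroB] minor by simp
  \<comment> \<open>The sign is a unit, so it can be cancelled in any commutative ring.\<close>
  have "?s * ?s = 1" by (simp add: sign_def)
  then show ?thesis using arg_cong[OF eq, of "(*) ?s"] by (simp flip: mult.assoc)
qed

section \<open>Closed walks in the fiber of a Hermitian matrix\<close>

lemma minor_singleton: "minor M {i} = M i i"
  by (simp add: minor_def)

lemma minor_pair:
  assumes "i \<noteq> j"
  shows "minor M {i, j} = M i i * M j j - M i j * M j i"
proof -
  have neq: "id \<noteq> Transposition.transpose i j"
    using assms by (metis id_apply transpose_apply_first)
  have "{p. p permutes {i, j}} = {id, Transposition.transpose i j}"
    by (auto simp only: permutes_doubleton_iff)
  then show ?thesis using neq assms by (simp add: minor_def sign_swap_id)
qed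

fun walk_prod :: "(nat \<Rightarrow> nat \<Rightarrow> 'a::comm_ring_1) \<Rightarrow> nat list \<Rightarrow> 'a" where
  "walk_prod M (x # y # zs) = M x y * walk_prod M (y # zs)"
| "walk_prod M _ = 1"

abbreviation (input) transp :: "(nat \<Rightarrow> nat \<Rightarrow> 'a) \<Rightarrow> nat \<Rightarrow> nat \<Rightarrow> 'a" where
  "transp M \<equiv> \<lambda>i j. M j i"

lemma walk_prod_join: "walk_prod M (xs @ x # ys) = walk_prod M (xs @ [x]) * walk_prod M (x # ys)"
proof (induction xs)
  case (Cons a xs)
  show ?case
  proof (cases xs)
    case (Cons b zs)
    with \<open>walk_prod M (xs @ x # ys) = walk_prod M (xs @ [x]) * walk_prod M (x # ys)\<close> show ?thesis
      by (simp add: mult_ac)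
  qed simp
qed simp

lemma walk_prod_append:
  "xs \<noteq> [] \<Longrightarrow> ys \<noteq> [] \<Longrightarrow> walk_prod M (xs @ ys) = walk_prod M xs * M (last xs) (hd ys) * walk_prod M ys"
proof (induction xs)
  case (Cons a xs)
  then show ?case by (cases xs; cases ys) (auto simp: mult_ac)
qed simp

lemma walk_prod_rev: "walk_prod M (rev xs) = walk_prod (transp M) xs"
proof (induction xs)
  case (Cons a xs)
  show ?case
  proof (cases "xs = []")
    case False
    then have "walk_prod M (rev xs @ [a]) = walk_prod (transp M) xs * M (hd xs) a"
      using walk_prod_append[of "rev xs" "[a]" M] Cons by (simp add: last_rev)
    also have "\<dots> = walk_prod (transp M) (a # xs)"
      using walk_prod_append[of "[a]" xs "transp M"] False by (simp add: mult_ac)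
    finally show ?thesis by simp
  qed simp
qed simp

lemma walk_prod_nth: "walk_prod M xs = (\<Prod>i<length xs - 1. M (xs ! i) (xs ! Suc i))"
proof (induction xs)
  case (Cons a xs)
  then show ?case by (cases xs) (auto simp: prod.lessThan_Suc_shift simp del: prod.lessThan_Suc)
qed simp

lemma walk_prod_cycle:
  assumes "ys \<noteq> []"
  shows "walk_prod M (ys @ [hd ys]) = cycle_prod (length ys) (\<lambda>i j. M (ys ! i) (ys ! j))"
  unfolding walk_prod_nth cycle_prod_def
proof (rule prod.cong)
  fix i assume i: "i \<in> {..<length ys}"
  show "M ((ys @ [hd ys]) ! i) ((ys @ [hd ys]) ! Suc i) = M (ys ! i) (ys ! rot (length ys) i)"
    using i assms by (cases "Suc i < length ys") (auto simp: nth_append rot_def hd_conv_nth)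
qed simp

text \<open>
  \<open>F\<close> and \<open>R\<close> are the roots of the polynomial with roots \<open>a\<close> and \<open>cnj a\<close>.
\<close>
lemma conjugate_pair:
  fixes a F R :: complex
  assumes "F + R = a + cnj a" "F * R = a * cnj a"
  shows "cmod F = cmod R"
proof -
  have "(F - a) * (F - cnj a) = F * F - F * (a + cnj a) + a * cnj a"
    by (simp add: algebra_simps)
  also have "\<dots> = 0" unfolding assms[symmetric] by (simp add: algebra_simps)
  finally have "F = a \<or> F = cnj a" by simp
  then show ?thesis
  proof
    assume "F = a"
    then have "R = cnj a" using assms(1) by simp
    then show ?thesis using \<open>F = a\<close> by simp
  next
    assume "F = cnj a"
    then have "R = a" using assms(1) by simp
    then show ?thesis using \<open>F = cnj a\<close> by simp
  qed
qed

text \<open>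
  A chord splits a closed walk into two closed walks, one using the chord in either direction.  Here
  \<open>p, q\<close> are the moduli along the two parts, \<open>p', q'\<close> those of the reversed parts, and \<open>b, b'\<close> the
  moduli of the chord.  It suffices that the chord is present in one direction.
\<close>
lemma chord_cancel:
  fixes p p' q q' b b' :: real
  assumes "p * b' = p' * b" "q * b = q' * b'" "b \<noteq> 0 \<or> b' \<noteq> 0"
  shows "p * q = p' * q'"
proof (cases "b = 0 \<or> b' = 0")
  case True
  then show ?thesis using assms by auto
next
  case False
  have "p * q * (b * b') = (p * b') * (q * b)" by (simp only: mult_ac)
  also have "\<dots> = (p' * b) * (q' * b')" by (simp only: assms)
  also have "\<dots> = p' * q' * (b * b')" by (simp only: mult_ac)
  finally have "p * q * (b * b') = p' * q' * (b * b')" .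
  then show ?thesis using False by simp
qed

lemma list_split_two:
  assumes "i < j" "j < length ys"
  shows "ys = take i ys @ ys ! i # take (j - Suc i) (drop (Suc i) ys) @ ys ! j # drop (Suc j) ys"
proof -
  have "drop (Suc i) ys = take (j - Suc i) (drop (Suc i) ys) @ drop (Suc i) ys ! (j - Suc i)
      # drop (Suc (j - Suc i)) (drop (Suc i) ys)"
    by (rule id_take_nth_drop) (use assms in auto)
  also have "drop (Suc i) ys ! (j - Suc i) = ys ! j" using assms by simp
  also have "drop (Suc (j - Suc i)) (drop (Suc i) ys) = drop (Suc j) ys" using assms by simp
  finally have e: "drop (Suc i) ys = take (j - Suc i) (drop (Suc i) ys) @ ys ! j # drop (Suc j) ys" .
  have "take i ys @ ys ! i # take (j - Suc i) (drop (Suc i) ys) @ ys ! j # drop (Suc j) ys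
      = take i ys @ ys ! i # drop (Suc i) ys" by (simp only: e[symmetric])
  also have "\<dots> = ys" by (rule id_take_nth_drop[symmetric]) (use assms in simp)
  finally show ?thesis by (rule sym)
qed

definition arcs :: "nat set \<Rightarrow> (nat \<Rightarrow> nat \<Rightarrow> 'a::zero) \<Rightarrow> (nat \<times> nat) set" where
  "arcs V M = {(x, y). x \<in> V \<and> y \<in> V \<and> M x y \<noteq> 0}"

text \<open>
  \<open>B\<close> is in the fiber of the Hermitian matrix \<open>A\<close>, with rows and columns labelled by \<open>V\<close>.
\<close>
locale hermitian_minors =
  fixes V :: "nat set" and A B :: "nat \<Rightarrow> nat \<Rightarrow> complex"
  assumes fin: "finite V"
    and herm: "\<And>i j. i \<in> V \<Longrightarrow> j \<in> V \<Longrightarrow> A j i = cnj (A i j)"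
    and minors: "\<And>S. S \<subseteq> V \<Longrightarrow> minor B S = minor A S"
begin

lemma diag_eq: "i \<in> V \<Longrightarrow> B i i = A i i"
  using minors[of "{i}"] by (simp add: minor_singleton)

lemma prod_eq: "i \<in> V \<Longrightarrow> j \<in> V \<Longrightarrow> B i j * B j i = A i j * A j i"
proof (cases "i = j")
  case False
  assume "i \<in> V" "j \<in> V"
  then show ?thesis using minors[of "{i, j}"] False by (simp add: minor_pair diag_eq)
qed (simp add: diag_eq)

text \<open>
  Since \<open>B i j * B j i = \<bar>A i j\<bar>\<^sup>2\<close>, an edge of \<open>A\<close> is a pair of opposite arcs of \<open>B\<close>.  The
  opposite of a single arc of \<open>B\<close> may be missing; excluding this inside a component is the main difficulty.
\<close>
lemma A_zero_iff: "i \<in> V \<Longrightarrow> j \<in> V \<Longrightarrow> A i j = 0 \<longleftrightarrow> B i j * B j i = 0"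
  using prod_eq[of i j] herm[of i j] by simp

text \<open>
  By \<open>A_zero_iff\<close> a chord missing in \<open>B\<close> is also missing in \<open>A\<close>, so \<open>cycle_minor\<close> applies.  For \<open>A\<close> the
  two cycle products are complex conjugates.
\<close>
lemma chordless_balanced:
  assumes ys: "distinct ys" "set ys \<subseteq> V" "3 \<le> length ys"
    and chordless: "\<And>i j. i < length ys \<Longrightarrow> j < length ys \<Longrightarrow> i \<noteq> j \<Longrightarrow>
      j \<noteq> rot (length ys) i \<Longrightarrow> i \<noteq> rot (length ys) j \<Longrightarrow> B (ys ! i) (ys ! j) = 0"
  shows "cmod (walk_prod B (ys @ [hd ys])) = cmod (walk_prod (transp B) (ys @ [hd ys]))"
proof -
  let ?k = "length ys" and ?r = "\<lambda>M i j. M (ys ! i) (ys ! j)"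
  have V: "i < ?k \<Longrightarrow> ys ! i \<in> V" for i using ys(2) by auto
  have ne: "ys \<noteq> []" using ys(3) by auto
  have bij: "bij_betw (\<lambda>i. ys ! i) {0..<?k} (set ys)"
    using bij_betw_nth[OF ys(1) refl refl] by (simp add: atLeast0LessThan)
  have "cycle_prod ?k (?r B) + reverse_cycle_prod ?k (?r B) = cycle_prod ?k (?r A) + reverse_cycle_prod ?k (?r A)"
  proof (rule cycle_minor[OF ys(3)])
    fix i j assume ij: "i < ?k" "j < ?k" "i \<noteq> j" "j \<noteq> rot ?k i" "i \<noteq> rot ?k j"
    show "?r B i j = 0" using chordless[OF ij] .
    then show "?r A i j = 0" using A_zero_iff V ij by simp
  next
    show "minor (?r B) {0..<?k} = minor (?r A) {0..<?k}"
      using minors[OF ys(2)] by (simp add: minor_reindex[OF bij])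
  qed (use V in \<open>auto simp: diag_eq prod_eq\<close>)
  moreover have "reverse_cycle_prod ?k (?r A) = cnj (cycle_prod ?k (?r A))"
    unfolding reverse_cycle_prod_def cycle_prod_def cnj_prod by (rule prod.cong) (auto intro!: herm V simp: rot_less)
  moreover have "cycle_prod ?k (?r B) * reverse_cycle_prod ?k (?r B) = cycle_prod ?k (?r A) * reverse_cycle_prod ?k (?r A)"
    unfolding reverse_cycle_prod_def cycle_prod_def prod.distrib[symmetric]
    by (rule prod.cong) (auto simp: prod_eq V rot_less)
  ultimately have "cmod (cycle_prod ?k (?r B)) = cmod (reverse_cycle_prod ?k (?r B))"
    by (intro conjugate_pair) auto
  then show ?thesis unfolding walk_prod_cycle[OF ne] by (simp add: reverse_cycle_prod_def cycle_prod_def)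
qed

text \<open>
  Induction on the length.  A walk with a repeated vertex or a chord splits into shorter closed walks,
  and what remains is a chordless cycle or has at most two vertices.  Formulating the claim for all
  closed walks, including those with product zero, treats missing arcs and unequal moduli at once.
\<close>
lemma closed_balanced:
  assumes "set xs \<subseteq> V" "xs \<noteq> []" "hd xs = last xs"
  shows "cmod (walk_prod B xs) = cmod (walk_prod (transp B) xs)"
  using assms
proof (induction xs rule: length_induct)
  case (1 xs)
  note IH = 1(1)[rule_format]
  define ys where "ys = butlast xs"
  define z where "z = last xs"
  have xs: "xs = ys @ [z]" using 1(3) by (simp add: ys_def z_def)
  have V: "set ys \<subseteq> V" using 1(2) xs by auto
  show ?case
  proof (cases "distinct ys")
    case False
    then obtain as x bs cs where "ys = as @ [x] @ bs @ [x] @ cs"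
      using not_distinct_decomp by blast
    then have xs': "xs = as @ x # bs @ x # cs @ [z]" using xs by simp
    have "cmod (walk_prod B (x # bs @ [x])) = cmod (walk_prod (transp B) (x # bs @ [x]))"
      by (rule IH) (use 1(2) in \<open>auto simp: xs'\<close>)
    moreover have "cmod (walk_prod B (as @ x # cs @ [z])) = cmod (walk_prod (transp B) (as @ x # cs @ [z]))"
      by (rule IH) (use 1(2,4) in \<open>auto simp: xs' hd_append split: if_splits\<close>)
    moreover have "walk_prod M xs = walk_prod M (x # bs @ [x]) * walk_prod M (as @ x # cs @ [z])"
      for M :: "nat \<Rightarrow> nat \<Rightarrow> complex"
      unfolding xs' using walk_prod_join[of M as x "bs @ x # cs @ [z]"] walk_prod_join[of M as x "cs @ [z]"]
        walk_prod_join[of M "x # bs" x "cs @ [z]"] by (simp add: mult_ac)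
    ultimately show ?thesis by (simp add: norm_mult)
  next
    case dist: True
    consider "ys = []" | x where "ys = [x]" | x y where "ys = [x, y]" | "3 \<le> length ys"
      by (cases ys rule: list.exhaust; cases "tl ys"; cases "tl (tl ys)") auto
    then show ?thesis
    proof cases
      case 4
      then have "ys \<noteq> []" by auto
      then have z: "z = hd ys" using 1(4) xs by simp
      show ?thesis
      proof (cases "\<exists>as x bs y cs. ys = as @ x # bs @ y # cs \<and> bs \<noteq> [] \<and> (as \<noteq> [] \<or> cs \<noteq> [])
          \<and> (B x y \<noteq> 0 \<or> B y x \<noteq> 0)")
        case True
        then obtain as x bs y cs where ys: "ys = as @ x # bs @ y # cs" "bs \<noteq> []" "as \<noteq> [] \<or> cs \<noteq> []"
          and chord: "B x y \<noteq> 0 \<or> B y x \<noteq> 0" by blast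
        have xs': "xs = as @ x # bs @ y # cs @ [z]" using xs ys by simp
        \<comment> \<open>Both closed walks are shorter: one avoids \<open>as\<close>, \<open>cs\<close>, the other avoids \<open>bs\<close>.\<close>
        let ?p = "\<lambda>M. walk_prod M (x # bs @ [y])" and ?q = "\<lambda>M. walk_prod M (as @ [x]) * walk_prod M (y # cs @ [z])"
        have e: "walk_prod M (x # bs @ [y, x]) = ?p M * M y x" "walk_prod M (as @ x # y # cs @ [z]) = ?q M * M x y"
          "walk_prod M xs = ?p M * ?q M" for M :: "nat \<Rightarrow> nat \<Rightarrow> complex"
          unfolding xs' using walk_prod_join[of M "x # bs" y "[x]"] walk_prod_join[of M as x "y # cs @ [z]"]
            walk_prod_join[of M as x "bs @ y # cs @ [z]"] walk_prod_join[of M "x # bs" y "cs @ [z]"]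
          by (simp_all add: mult_ac)
        have "cmod (walk_prod B (x # bs @ [y, x])) = cmod (walk_prod (transp B) (x # bs @ [y, x]))"
          by (rule IH) (use 1(2) ys in \<open>auto simp: xs'\<close>)
        then have "cmod (?p B) * cmod (B y x) = cmod (?p (transp B)) * cmod (B x y)"
          unfolding e by (simp add: norm_mult)
        moreover have "cmod (walk_prod B (as @ x # y # cs @ [z])) = cmod (walk_prod (transp B) (as @ x # y # cs @ [z]))"
          by (rule IH) (use 1(2,4) ys in \<open>auto simp: xs' hd_append split: if_splits\<close>)
        then have "cmod (?q B) * cmod (B x y) = cmod (?q (transp B)) * cmod (B y x)"
          unfolding e by (simp add: norm_mult)
        ultimately have "cmod (?p B) * cmod (?q B) = cmod (?p (transp B)) * cmod (?q (transp B))"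
          by (rule chord_cancel) (use chord in auto)
        then show ?thesis unfolding e by (simp add: norm_mult)
      next
        case False
        have *: "B (ys ! i) (ys ! j) = 0 \<and> B (ys ! j) (ys ! i) = 0"
          if ij: "i < j" "j < length ys" "j \<noteq> Suc i" "i \<noteq> 0 \<or> j \<noteq> length ys - 1" for i j
        proof -
          have "take (j - Suc i) (drop (Suc i) ys) \<noteq> []" "take i ys \<noteq> [] \<or> drop (Suc j) ys \<noteq> []"
            using ij by auto
          with False list_split_two[OF ij(1,2)] show ?thesis by blast
        qed
        have last0: "rot (length ys) (length ys - 1) = 0" using 4 by (auto simp: rot_def)
        show ?thesis unfolding xs z
        proof (rule chordless_balanced[OF dist V 4])
          fix i j assume ij: "i < length ys" "j < length ys" "i \<noteq> j"
            "j \<noteq> rot (length ys) i" "i \<noteq> rot (length ys) j"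
          show "B (ys ! i) (ys ! j) = 0"
          proof (cases "i < j")
            case True
            then have "j \<noteq> Suc i" "i \<noteq> 0 \<or> j \<noteq> length ys - 1"
              using ij last0 by (auto simp: rot_def split: if_splits)
            then show ?thesis using *[of i j] ij True by simp
          next
            case False
            then have "j < i" "i \<noteq> Suc j" "j \<noteq> 0 \<or> i \<noteq> length ys - 1"
              using ij last0 by (auto simp: rot_def split: if_splits)
            then show ?thesis using *[of j i] ij by simp
          qed
        qed
      qed
    qed (use 1(4) in \<open>auto simp: xs mult.commute\<close>)
  qed
qed

lemma arcs_subset: "arcs V A \<subseteq> arcs V B"
proof (rule subrelI)
  fix x y assume "(x, y) \<in> arcs V A"
  then have "x \<in> V" "y \<in> V" "A x y \<noteq> 0" by (simp_all add: arcs_def)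
  then show "(x, y) \<in> arcs V B" using A_zero_iff[of x y] by (simp add: arcs_def)
qed

lemma arc_walk:
  assumes "(x, y) \<in> (arcs V B)\<^sup>*" "x \<in> V"
  shows "\<exists>xs. xs \<noteq> [] \<and> set xs \<subseteq> V \<and> hd xs = x \<and> last xs = y \<and> walk_prod B xs \<noteq> 0"
  using assms
proof (induction rule: rtrancl_induct)
  case base
  then show ?case by (intro exI[of _ "[x]"]) auto
next
  case (step y z)
  then obtain xs where "xs \<noteq> [] \<and> set xs \<subseteq> V \<and> hd xs = x \<and> last xs = y \<and> walk_prod B xs \<noteq> 0" by auto
  then show ?case using step
    by (intro exI[of _ "xs @ [z]"]) (auto simp: walk_prod_append arcs_def)
qed

lemma edge_walk:
  assumes "(x, y) \<in> (arcs V A)\<^sup>*" "x \<in> V"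
  shows "\<exists>xs. xs \<noteq> [] \<and> set xs \<subseteq> V \<and> hd xs = x \<and> last xs = y \<and> walk_prod B xs \<noteq> 0 \<and> walk_prod (transp B) xs \<noteq> 0"
  using assms
proof (induction rule: rtrancl_induct)
  case base
  then show ?case by (intro exI[of _ "[x]"]) auto
next
  case (step y z)
  then obtain xs where "xs \<noteq> [] \<and> set xs \<subseteq> V \<and> hd xs = x \<and> last xs = y
      \<and> walk_prod B xs \<noteq> 0 \<and> walk_prod (transp B) xs \<noteq> 0" by auto
  then show ?case using step
    using A_zero_iff[of y z] by (intro exI[of _ "xs @ [z]"]) (auto simp: walk_prod_append arcs_def)
qed

text \<open>
  The arc and the returning walk form a closed walk with nonzero product; by balance the reversal
  has nonzero product, so the opposite arc is present.
\<close>
lemma arc_returns: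
  assumes "(x, y) \<in> arcs V B" "(y, x) \<in> (arcs V B)\<^sup>*"
  shows "(x, y) \<in> arcs V A"
proof -
  have V: "x \<in> V" "y \<in> V" and b: "B x y \<noteq> 0" using assms(1) by (auto simp: arcs_def)
  obtain xs where xs: "xs \<noteq> []" "set xs \<subseteq> V" "hd xs = y" "last xs = x" "walk_prod B xs \<noteq> 0"
    using arc_walk[OF assms(2) V(2)] by auto
  have "cmod (walk_prod B (x # xs)) = cmod (walk_prod (transp B) (x # xs))"
    by (rule closed_balanced) (use xs V in auto)
  then have "cmod (B x y * walk_prod B xs) = cmod (B y x * walk_prod (transp B) xs)"
    using walk_prod_append[of "[x]" xs B] walk_prod_append[of "[x]" xs "transp B"] xs by simp
  then have "B y x \<noteq> 0" using b xs by auto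
  then show ?thesis using V b by (simp add: arcs_def A_zero_iff)
qed

text \<open>
  The potential at \<open>x\<close> is the quotient of the moduli of the products along a walk from \<open>r\<close> to \<open>x\<close> and
  along its reversal.  Balance of the closed walk from \<open>r\<close> over \<open>x\<close> and \<open>y\<close> back to \<open>r\<close> is the
  claimed identity.
\<close>
lemma potential:
  assumes r: "r \<in> V" and conn: "\<And>x. x \<in> V \<Longrightarrow> (r, x) \<in> (arcs V A)\<^sup>*"
  shows "\<exists>\<phi>. (\<forall>x\<in>V. \<phi> x > (0::real)) \<and> (\<forall>x\<in>V. \<forall>y\<in>V. cmod (B x y) * \<phi> x = cmod (B y x) * \<phi> y)"
proof -
  have "\<forall>x\<in>V. \<exists>xs. xs \<noteq> [] \<and> set xs \<subseteq> V \<and> hd xs = r \<and> last xs = x \<and> walk_prod B xs \<noteq> 0 \<and> walk_prod (transp B) xs \<noteq> 0"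
    using edge_walk[OF conn r] by blast
  then obtain w where w: "\<And>x. x \<in> V \<Longrightarrow> w x \<noteq> [] \<and> set (w x) \<subseteq> V \<and> hd (w x) = r \<and> last (w x) = x
      \<and> walk_prod B (w x) \<noteq> 0 \<and> walk_prod (transp B) (w x) \<noteq> 0" by metis
  let ?\<phi> = "\<lambda>x. cmod (walk_prod B (w x)) / cmod (walk_prod (transp B) (w x))"
  have "cmod (B x y) * ?\<phi> x = cmod (B y x) * ?\<phi> y" if "x \<in> V" "y \<in> V" for x y
  proof -
    have x: "w x \<noteq> []" "set (w x) \<subseteq> V" "hd (w x) = r" "last (w x) = x" 
       and y: "w y \<noteq> []" "set (w y) \<subseteq> V" "hd (w y) = r" "last (w y) = y"
       and nz: "walk_prod (transp B) (w x) \<noteq> 0" "walk_prod (transp B) (w y) \<noteq> 0"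
      using w that by auto
    have "cmod (walk_prod B (w x @ rev (w y))) = cmod (walk_prod (transp B) (w x @ rev (w y)))"
      by (rule closed_balanced) (use x y in \<open>auto simp: last_rev\<close>)
    then have "cmod (walk_prod B (w x)) * cmod (B x y) * cmod (walk_prod (transp B) (w y))
        = cmod (walk_prod (transp B) (w x)) * cmod (B y x) * cmod (walk_prod B (w y))"
      using x y by (simp add: walk_prod_append walk_prod_rev hd_rev norm_mult)
    then show ?thesis using nz by (simp add: field_simps)
  qed
  moreover have "?\<phi> x > 0" if "x \<in> V" for x using w[OF that] by auto
  ultimately show ?thesis by (intro exI[of _ ?\<phi>] conjI ballI)
qed

end

section \<open>Block forms and reducibility\<close>

lemma submatrix_zero_iff:
  assumes M: "M \<in> carrier_mat n n" and I: "I \<subseteq> {0..<n}" and J: "J \<subseteq> {0..<n}"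
  shows "submatrix M I J = 0\<^sub>m (card I) (card J) \<longleftrightarrow> (\<forall>i\<in>I. \<forall>j\<in>J. M $$ (i, j) = 0)"
proof -
  have fin: "finite I" "finite J" using I J finite_subset by blast+
  have bI: "pick I ` {0..<card I} = I" and bJ: "pick J ` {0..<card J} = J"
    using bij_betw_pick[OF fin(1)] bij_betw_pick[OF fin(2)] by (auto simp: bij_betw_def)
  note c = submatrix_carrier[OF M I J]
  have "submatrix M I J = 0\<^sub>m (card I) (card J) \<longleftrightarrow>
    (\<forall>a<card I. \<forall>b<card J. submatrix M I J $$ (a, b) = 0)"
    using c(1) by (auto simp: mat_eq_iff)
  also have "\<dots> \<longleftrightarrow> (\<forall>a\<in>{0..<card I}. \<forall>b\<in>{0..<card J}. M $$ (pick I a, pick J b) = 0)"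
    using c(2) by auto
  also have "\<dots> \<longleftrightarrow> (\<forall>i\<in>pick I ` {0..<card I}. \<forall>j\<in>pick J ` {0..<card J}. M $$ (i, j) = 0)"
    by simp
  finally show ?thesis unfolding bI bJ .
qed

lemma pick_interval: "i < m \<Longrightarrow> pick {a..<a + m} i = a + i"
proof -
  assume i: "i < m"
  then have "{x \<in> {a..<a + m}. x < a + i} = {a..<a + i}" by auto
  then have "card {x \<in> {a..<a + m}. x < a + i} = i" by simp
  then show ?thesis using pick_card_in_set[of "a + i" "{a..<a + m}"] i by simp
qed

lemma pick_initial: "i < n \<Longrightarrow> pick {0..<n} i = i"
  using pick_interval[of i n 0] by simp

lemma submatrix_full: "M \<in> carrier_mat n n \<Longrightarrow> submatrix M {0..<n} {0..<n} = M"
proof (rule eq_matI)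
  assume M: "M \<in> carrier_mat n n"
  note c = submatrix_carrier[OF M order_refl order_refl]
  show "dim_row (submatrix M {0..<n} {0..<n}) = dim_row M" 
    "dim_col (submatrix M {0..<n} {0..<n}) = dim_col M" using c(1) M by auto
  fix i j assume "i < dim_row M" "j < dim_col M"
  then show "submatrix M {0..<n} {0..<n} $$ (i, j) = M $$ (i, j)"
    using c(2)[of i j] M by (simp add: pick_initial)
qed

definition start :: "(nat \<Rightarrow> nat set) \<Rightarrow> nat \<Rightarrow> nat" where
  "start T k = (\<Sum>l<k. card (T l))"

lemma start_Suc: "start T (Suc k) = start T k + card (T k)"
  by (simp add: start_def)

lemma start_position:
  "i < start T s \<Longrightarrow> \<exists>k a. k < s \<and> a < card (T k) \<and> i = start T k + a"
proof (induction s)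
  case (Suc s)
  show ?case
  proof (cases "i < start T s")
    case True
    then show ?thesis using Suc.IH less_Suc_eq by blast
  next
    case False
    then show ?thesis using Suc.prems
      by (intro exI[of _ s] exI[of _ "i - start T s"]) (auto simp: start_Suc)
  qed
qed (simp add: start_def)

lemma start_mono: "k \<le> l \<Longrightarrow> start T k \<le> start T l"
  unfolding start_def by (rule sum_mono2) auto

lemma sum_list_take_map_upt:
  "k \<le> s \<Longrightarrow> sum_list (take k (map f [0..<s])) = (\<Sum>l<k. f l)" for f :: "nat \<Rightarrow> nat"
  by (simp add: take_map interv_sum_list_conv_sum_set_nat atLeast0LessThan)

lemma block_inds_start:
  "k < s \<Longrightarrow> block_inds (map (\<lambda>k. card (T k)) [0..<s]) k = {start T k..<start T k + card (T k)}"
  unfolding block_inds_def by (simp add: sum_list_take_map_upt start_def del: take_Suc upt_Suc)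

definition layout_list :: "(nat \<Rightarrow> nat set) \<Rightarrow> nat \<Rightarrow> nat list" where
  "layout_list T s = concat (map (\<lambda>k. map (pick (T k)) [0..<card (T k)]) [0..<s])"

text \<open>
  The permutation that lists the elements of \<open>T 0\<close> in increasing order, then those of \<open>T 1\<close>, and so on.
\<close>
definition layout :: "(nat \<Rightarrow> nat set) \<Rightarrow> nat \<Rightarrow> nat \<Rightarrow> nat" where
  "layout T s i = (if i < start T s then layout_list T s ! i else i)"

lemma layout_list_Suc:
  "layout_list T (Suc s) = layout_list T s @ map (pick (T s)) [0..<card (T s)]"
  by (simp add: layout_list_def)

lemma length_layout_list: "length (layout_list T s) = start T s"
  by (induction s) (simp_all add: layout_list_Suc start_Suc, simp_all add: layout_list_def start_def)

lemma layout_list_nth: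
  "k < s \<Longrightarrow> a < card (T k) \<Longrightarrow> layout_list T s ! (start T k + a) = pick (T k) a"
proof (induction s)
  case (Suc s)
  show ?case
  proof (cases "k = s")
    case True
    then show ?thesis using Suc.prems
      by (simp add: layout_list_Suc nth_append length_layout_list)
  next
    case False
    then have k: "k < s" using Suc.prems by simp
    then have "start T (Suc k) \<le> start T s" by (intro start_mono) simp
    then have "start T k + a < start T s" using Suc.prems(2) by (simp add: start_Suc)
    then show ?thesis using Suc k
      by (simp add: layout_list_Suc nth_append length_layout_list)
  qed
qed simp

locale index_partition =
  fixes n s :: nat and T :: "nat \<Rightarrow> nat set"
  assumes union: "(\<Union>k<s. T k) = {0..<n}" and disj: "disjoint_family_on T {..<s}"
begin

lemma T_sub: "k < s \<Longrightarrow> T k \<subseteq> {0..<n}"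
  using union by auto

lemma T_fin: "k < s \<Longrightarrow> finite (T k)"
  using T_sub finite_subset by blast

lemma start_n: "start T s = n"
proof -
  have "start T s = card (\<Union>k<s. T k)"
    unfolding start_def
    by (rule card_UN_disjoint[symmetric])
       (use T_fin disjoint_family_onD[OF disj] in auto)
  then show ?thesis by (simp add: union)
qed

lemma layout_start:
  assumes "k < s" "a < card (T k)"
  shows "start T k + a < n" "layout T s (start T k + a) = pick (T k) a"
proof -
  have "start T (Suc k) \<le> start T s" using assms(1) by (intro start_mono) simp
  then show "start T k + a < n" using assms by (simp add: start_n start_Suc)
  then show "layout T s (start T k + a) = pick (T k) a"
    using assms by (simp add: layout_def layout_list_nth start_n)
qed

lemma position:
  assumes "i < n" obtains k a where "k < s" "a < card (T k)" "i = start T k + a"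
  using start_position[of i T s] assms by (auto simp: start_n)

lemma layout_permutes: "layout T s permutes {0..<n}"
proof (rule bij_imp_permutes)
  have "layout T s ` {0..<n} = {0..<n}"
  proof
    show "layout T s ` {0..<n} \<subseteq> {0..<n}"
    proof
      fix x assume "x \<in> layout T s ` {0..<n}"
      then obtain i where i: "i < n" "x = layout T s i" by auto
      from i(1) obtain k a where k: "k < s" "a < card (T k)" "i = start T k + a" by (rule position)
      then have "x = pick (T k) a" using i layout_start by simp
      then show "x \<in> {0..<n}" using pick_in_set_le[OF k(2)] T_sub[OF k(1)] by auto
    qed
    show "{0..<n} \<subseteq> layout T s ` {0..<n}"
    proof
      fix x assume "x \<in> {0..<n}"
      then obtain k where k: "k < s" "x \<in> T k" using union by blast
      then obtain a where a: "a < card (T k)" "x = pick (T k) a"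
      proof -
        have "x \<in> pick (T k) ` {0..<card (T k)}"
          using bij_betw_pick[OF T_fin[OF k(1)]] k(2) by (simp add: bij_betw_def)
        then show thesis using that by auto
      qed
      then show "x \<in> layout T s ` {0..<n}"
        using layout_start[OF k(1) a(1)] by (auto intro!: image_eqI[of _ _ "start T k + a"])
    qed
  qed
  then show "bij_betw (layout T s) {0..<n} {0..<n}"
    by (simp add: bij_betw_def eq_card_imp_inj_on)
qed (simp add: layout_def start_n)

abbreviation (input) ds where "ds \<equiv> map (\<lambda>k. card (T k)) [0..<s]"

lemma block_sub: "k < s \<Longrightarrow> block_inds ds k \<subseteq> {0..<n}"
  using layout_start(1)[of k] start_mono[of "Suc k" s T]
  by (auto simp: block_inds_start start_n start_Suc)

lemma layout_block: 
  assumes k: "k < s" shows "layout T s ` block_inds ds k = T k"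
proof -
  have "block_inds ds k = (\<lambda>a. start T k + a) ` {0..<card (T k)}"
    unfolding block_inds_start[OF k] by (simp add: image_add_atLeastLessThan add.commute)
  then have "layout T s ` block_inds ds k = (\<lambda>a. layout T s (start T k + a)) ` {0..<card (T k)}"
    by (simp only: image_image)
  also have "\<dots> = pick (T k) ` {0..<card (T k)}"
    by (rule image_cong) (use layout_start[OF k] in auto)
  also have "\<dots> = T k" using bij_betw_pick[OF T_fin[OF k]] by (simp add: bij_betw_def)
  finally show ?thesis .
qed

text \<open>
  Each block is listed in increasing order, so extracting a block after the permutation gives the
  submatrix itself and not merely a simultaneous rearrangement of it.
\<close>
lemma submatrix_layout:
  assumes M: "M \<in> carrier_mat n n" and k: "k < s" and l: "l < s"
  shows "submatrix (permute_mat (layout T s) M) (block_inds ds k) (block_inds ds l)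
    = submatrix M (T k) (T l)"
proof -
  have C: "permute_mat (layout T s) M \<in> carrier_mat n n" using M by (simp add: permute_mat_def)
  note c = submatrix_carrier[OF C block_sub[OF k] block_sub[OF l]]
  note m = submatrix_carrier[OF M T_sub[OF k] T_sub[OF l]]
  have d: "card (block_inds ds k) = card (T k)" "card (block_inds ds l) = card (T l)"
    using k l by (simp_all add: block_inds_start)
  show ?thesis
  proof (rule eq_matI)
    fix i j assume "i < dim_row (submatrix M (T k) (T l))" "j < dim_col (submatrix M (T k) (T l))"
    then have ij: "i < card (T k)" "j < card (T l)" using m by auto
    have p: "pick (block_inds ds k) i = start T k + i" "pick (block_inds ds l) j = start T l + j"
      using k l ij by (simp_all add: block_inds_start pick_interval)
    show "submatrix (permute_mat (layout T s) M) (block_inds ds k) (block_inds ds l) $$ (i, j)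
        = submatrix M (T k) (T l) $$ (i, j)"
      using c(2)[of i j] m(2)[of i j] ij M layout_start[OF k ij(1)] layout_start[OF l ij(2)]
      by (simp add: d p permute_mat_def)
  qed (use c m d in auto)
qed

lemma layout_triangular:
  assumes M: "M \<in> carrier_mat n n" and ne: "\<And>k. k < s \<Longrightarrow> T k \<noteq> {}"
    and zero: "\<And>k l i j. k < s \<Longrightarrow> l < k \<Longrightarrow> i \<in> T k \<Longrightarrow> j \<in> T l \<Longrightarrow> M $$ (i, j) = 0"
  shows "block_upper_triangular ds (permute_mat (layout T s) M)"
  unfolding block_upper_triangular_def
proof (intro conjI ballI allI impI)
  have "sum_list ds = n" using start_n sum_list_take_map_upt[of s s "\<lambda>k. card (T k)"]
    by (simp add: start_def)
  then show "permute_mat (layout T s) M \<in> carrier_mat (sum_list ds) (sum_list ds)"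
    using M by (simp add: permute_mat_def)
  show "0 < d" if "d \<in> set ds" for d using that ne T_fin by (auto simp: card_gt_0_iff)
  fix k l assume "k < length ds" "l < k"
  then have kl: "k < s" "l < s" "l < k" by auto
  then have "submatrix M (T k) (T l) = 0\<^sub>m (card (T k)) (card (T l))"
    using submatrix_zero_iff[OF M T_sub[OF kl(1)] T_sub[OF kl(2)]] zero by blast
  then show "submatrix (permute_mat (layout T s) M) (block_inds ds k) (block_inds ds l)
      = 0\<^sub>m (ds ! k) (ds ! l)"
    using submatrix_layout[OF M kl(1,2)] kl by simp
qed

lemma layout_diagonal:
  assumes M: "M \<in> carrier_mat n n"
    and zero: "\<And>k l i j. k < s \<Longrightarrow> l < s \<Longrightarrow> k \<noteq> l \<Longrightarrow> i \<in> T k \<Longrightarrow> j \<in> T l \<Longrightarrow> M $$ (i, j) = 0"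
  shows "permute_mat (layout T s) M = diag_block_mat (map (\<lambda>k. submatrix M (T k) (T k)) [0..<s])"
proof -
  let ?C = "permute_mat (layout T s) M" and ?F = "\<lambda>k. submatrix M (T k) (T k)"
  let ?D = "\<lambda>m. diag_block_mat (map ?F [0..<m])"
  have C: "?C \<in> carrier_mat n n" using M by (simp add: permute_mat_def)
  have entry: "?C $$ (start T k + a, start T l + b) = (if k = l then ?F k $$ (a, b) else 0)"
    if "k < s" "l < s" "a < card (T k)" "b < card (T l)" for k l a b
    using that layout_start[OF that(1,3)] layout_start[OF that(2,4)] M
      submatrix_carrier(2)[OF M T_sub T_sub, of k k a b] zero[of k l] pick_in_set_le[OF that(3)]
      pick_in_set_le[OF that(4)]
    by (auto simp: permute_mat_def)
  have "?D m \<in> carrier_mat (start T m) (start T m) \<and>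
     (\<forall>k l a b. k < m \<longrightarrow> l < m \<longrightarrow> a < card (T k) \<longrightarrow> b < card (T l) \<longrightarrow>
       ?D m $$ (start T k + a, start T l + b) = (if k = l then ?F k $$ (a, b) else 0))"
    if "m \<le> s" for m
    using that
  proof (induction m)
    case 0
    then show ?case by (simp add: start_def)
  next
    case (Suc m)
    have F: "?F m \<in> carrier_mat (card (T m)) (card (T m))"
      by (rule submatrix_carrier(1)[OF M]) (use T_sub Suc.prems in auto)
    have D: "?D m \<in> carrier_mat (start T m) (start T m)" using Suc by simp
    have DS: "?D (Suc m) = four_block_mat (?D m) (0\<^sub>m (start T m) (card (T m)))
        (0\<^sub>m (card (T m)) (start T m)) (?F m)"
      using D F by (simp add: diag_block_mat_last Let_def)
    have lt: "start T k + a < start T m" if "k < m" "a < card (T k)" for k a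
      using start_mono[of "Suc k" m T] that by (simp add: start_Suc)
    show ?case
    proof (intro conjI allI impI)
      show "?D (Suc m) \<in> carrier_mat (start T (Suc m)) (start T (Suc m))"
        unfolding DS start_Suc by (rule four_block_carrier_mat[OF D F])
      fix k l a b assume kl: "k < Suc m" "l < Suc m" "a < card (T k)" "b < card (T l)"
      have IH: "?D m $$ (start T k + a, start T l + b) = (if k = l then ?F k $$ (a, b) else 0)"
        if "k < m" "l < m" using Suc kl that by simp
      show "?D (Suc m) $$ (start T k + a, start T l + b) = (if k = l then ?F k $$ (a, b) else 0)"
        using kl D F lt[of k a] lt[of l b] IH unfolding DS
        by (cases "k < m"; cases "l < m") (auto simp: less_Suc_eq)
    qed
  qed
  from this[OF order_refl] have D: "?D s \<in> carrier_mat n n"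
    and e: "\<And>k l a b. k < s \<Longrightarrow> l < s \<Longrightarrow> a < card (T k) \<Longrightarrow> b < card (T l) \<Longrightarrow>
       ?D s $$ (start T k + a, start T l + b) = (if k = l then ?F k $$ (a, b) else 0)"
    by (auto simp: start_n)
  show ?thesis
  proof (rule eq_matI)
    fix i j assume "i < dim_row (?D s)" "j < dim_col (?D s)"
    then have ij: "i < n" "j < n" using D by auto
    from ij(1) obtain k a where k: "k < s" "a < card (T k)" "i = start T k + a" by (rule position)
    from ij(2) obtain l b where l: "l < s" "b < card (T l)" "j = start T l + b" by (rule position)
    show "?C $$ (i, j) = ?D s $$ (i, j)"
      unfolding k(3) l(3) entry[OF k(1) l(1) k(2) l(2)] e[OF k(1) l(1) k(2) l(2)] ..
  qed (use C D in auto)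
qed

end

lemma block_inds_cover:
  "i < sum_list ds \<Longrightarrow> \<exists>k<length ds. i \<in> block_inds ds k"
proof (induction ds rule: rev_induct)
  case (snoc d ds)
  show ?case
  proof (cases "i < sum_list ds")
    case True
    then obtain k where "k < length ds" "i \<in> block_inds ds k" using snoc by auto
    then show ?thesis by (intro exI[of _ k]) (auto simp: block_inds_def)
  next
    case False
    then show ?thesis using snoc.prems
      by (intro exI[of _ "length ds"]) (auto simp: block_inds_def)
  qed
qed simp

lemma card_block_inds: "k < length ds \<Longrightarrow> card (block_inds ds k) = ds ! k"
  by (simp add: block_inds_def take_Suc_conv_app_nth)

lemma block_inds_sub: "block_inds ds k \<subseteq> {0..<sum_list ds}"
proof -
  have "sum_list (take (Suc k) ds) \<le> sum_list (take (Suc k) ds @ drop (Suc k) ds)"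
    by (simp only: sum_list_append le_add1)
  then show ?thesis by (auto simp: block_inds_def)
qed

lemma block_upper_triangularD:
  assumes "block_upper_triangular ds C" "k < length ds" "l < k"
    "i \<in> block_inds ds k" "j \<in> block_inds ds l"
  shows "C $$ (i, j) = 0"
proof -
  have C: "C \<in> carrier_mat (sum_list ds) (sum_list ds)"
    and "submatrix C (block_inds ds k) (block_inds ds l) = 0\<^sub>m (ds ! k) (ds ! l)"
    using assms(1-3) by (auto simp: block_upper_triangular_def)
  then show ?thesis
    using submatrix_zero_iff[OF C block_inds_sub block_inds_sub, of k l] assms(2-5)
    by (simp add: card_block_inds)
qed

text \<open>
  Reducibility depends only on the support of the matrix.  From a block triangular form with at least
  two blocks, \<open>U\<close> is everything after the first block; conversely \<open>U\<close> and its complement are the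
  two blocks.
\<close>
lemma reducible_iff:
  assumes M: "M \<in> carrier_mat n n"
  shows "reducible_mat M \<longleftrightarrow>
    (\<exists>U. U \<noteq> {} \<and> U \<subset> {0..<n} \<and> (\<forall>i\<in>U. \<forall>j\<in>{0..<n} - U. M $$ (i, j) = 0))"
proof
  assume "reducible_mat M"
  then obtain p ds where p: "p permutes {0..<n}" and len: "length ds \<ge> 2"
    and but: "block_upper_triangular ds (permute_mat p M)"
    using M by (auto simp: reducible_mat_def)
  let ?C = "permute_mat p M"
  have C: "?C \<in> carrier_mat n n" using M by (simp add: permute_mat_def)
  then have n: "sum_list ds = n" using but by (auto simp: block_upper_triangular_def)
  obtain d e ds' where ds: "ds = d # e # ds'"
    using len by (metis One_nat_def Suc_1 Suc_le_length_iff)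
  have de: "d > 0" "e > 0" "d + e \<le> n" using but n by (auto simp: ds block_upper_triangular_def)
  have b0: "block_inds ds 0 = {0..<d}" by (simp add: ds block_inds_def)
  have zero: "?C $$ (i, j) = 0" if ij: "d \<le> i" "i < n" "j < d" for i j
  proof -
    obtain k where k: "k < length ds" "i \<in> block_inds ds k"
      using block_inds_cover[of i ds] ij n by auto
    then have "k \<noteq> 0" using b0 ij by (metis atLeastLessThan_iff not_le)
    then have k0: "0 < k" by simp
    have j0: "j \<in> block_inds ds 0" using ij(3) unfolding b0 by simp
    show ?thesis by (rule block_upper_triangularD[OF but k(1) k0 k(2) j0])
  qed
  let ?U = "p ` {d..<n}"
  have pn: "p ` {0..<n} = {0..<n}" using permutes_image[OF p] .
  have inj: "inj p" using permutes_inj[OF p] .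
  have "{0..<n} - ?U = p ` ({0..<n} - {d..<n})"
    using pn inj by (metis image_set_diff)
  also have "{0..<n} - {d..<n} = {0..<d}" using de by auto
  finally have compl: "{0..<n} - ?U = p ` {0..<d}" .
  have "M $$ (i, j) = 0" if ij: "i \<in> ?U" "j \<in> {0..<n} - ?U" for i j
  proof -
    obtain i' where i': "i = p i'" "i' \<in> {d..<n}" using ij(1) by blast
    have "j \<in> p ` {0..<d}" using ij(2) by (simp only: compl)
    then obtain j' where j': "j = p j'" "j' \<in> {0..<d}" by blast
    have "d \<le> i'" "i' < n" "j' < d" using i' j' by auto
    note ij = i'(1) j'(1) this
    then show ?thesis using zero[of i' j'] de M by (simp add: permute_mat_def)
  qed
  moreover have "?U \<noteq> {}" using de by simp
  moreover have "?U \<subset> {0..<n}"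
  proof -
    have "?U \<subseteq> {0..<n}" using pn by auto
    moreover have "{0..<n} - ?U \<noteq> {}" unfolding compl using de by simp
    ultimately show ?thesis by blast
  qed
  ultimately show "\<exists>U. U \<noteq> {} \<and> U \<subset> {0..<n} \<and> (\<forall>i\<in>U. \<forall>j\<in>{0..<n} - U. M $$ (i, j) = 0)"
    by (intro exI[of _ ?U] conjI ballI)
next
  assume "\<exists>U. U \<noteq> {} \<and> U \<subset> {0..<n} \<and> (\<forall>i\<in>U. \<forall>j\<in>{0..<n} - U. M $$ (i, j) = 0)"
  then obtain U where U: "U \<noteq> {}" "U \<subset> {0..<n}" "\<And>i j. i \<in> U \<Longrightarrow> j \<in> {0..<n} - U \<Longrightarrow> M $$ (i, j) = 0"
    by blast
  define T where "T k = (if k = 0 then {0..<n} - U else U)" for k :: nat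
  have two: "{..<2::nat} = {0, 1}" by auto
  interpret index_partition n 2 T
    by standard (use U(2) in \<open>auto simp: T_def disjoint_family_on_def two\<close>)
  have "block_upper_triangular ds (permute_mat (layout T 2) M)"
    by (rule layout_triangular[OF M]) (use U in \<open>auto simp: T_def split: if_splits\<close>)
  then show "reducible_mat M"
    unfolding reducible_mat_def using layout_permutes M
    by (intro exI[of _ "layout T 2"] exI[of _ ds]) auto
qed

section \<open>The fiber of an irreducible Hermitian matrix\<close>

lemma hermitian_mat_iff:
  assumes A: "A \<in> carrier_mat m m"
  shows "hermitian_mat A \<longleftrightarrow> (\<forall>i<m. \<forall>j<m. cnj (A $$ (j, i)) = A $$ (i, j))"
proof -
  have e: "mat_adjoint A $$ (i, j) = cnj (A $$ (j, i))" if "i < m" "j < m" for i j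
    using A that by (simp add: mat_adjoint_def mat_of_rows_def)
  have c: "mat_adjoint A \<in> carrier_mat m m"
  proof (rule carrier_matI)
    show "dim_row (mat_adjoint A) = m" "dim_col (mat_adjoint A) = m"
      unfolding mat_adjoint_def using carrier_matD[OF A] by simp_all
  qed
  have "hermitian_mat A \<longleftrightarrow> mat_adjoint A = A"
    using A by (simp add: hermitian_mat_def)
  also have "\<dots> \<longleftrightarrow> (\<forall>i<m. \<forall>j<m. mat_adjoint A $$ (i, j) = A $$ (i, j))"
  proof
    assume "\<forall>i<m. \<forall>j<m. mat_adjoint A $$ (i, j) = A $$ (i, j)"
    then show "mat_adjoint A = A" using c A by (intro eq_matI) auto
  qed simp
  also have "\<dots> \<longleftrightarrow> (\<forall>i<m. \<forall>j<m. cnj (A $$ (j, i)) = A $$ (i, j))"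
    using e by simp
  finally show ?thesis .
qed

lemma hermitian_entry:
  assumes "A \<in> carrier_mat m m" "hermitian_mat A" "i < m" "j < m"
  shows "A $$ (j, i) = cnj (A $$ (i, j))"
  using assms hermitian_mat_iff[OF assms(1)] by simp

lemma fiber_hermitian_minors:
  assumes A: "A \<in> carrier_mat m m" "hermitian_mat A" and B: "B \<in> fiber A"
  shows "hermitian_minors {0..<m} (entries A) (entries B)"
proof
  fix i j assume "i \<in> {0..<m}" "j \<in> {0..<m}"
  then show "A $$ (j, i) = cnj (A $$ (i, j))" by (intro hermitian_entry[OF A]) auto
next
  fix S assume "S \<subseteq> {0..<m}"
  then show "minor (entries B) S = minor (entries A) S" using B fiber_iff[OF A(1)] by blast
qed simp

lemma sym_arcs_hermitian:
  assumes A: "A \<in> carrier_mat m m" "hermitian_mat A"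
  shows "sym (arcs {0..<m} (entries A))"
proof (rule symI)
  fix i j assume "(i, j) \<in> arcs {0..<m} (entries A)"
  then have ij: "i < m" "j < m" "A $$ (i, j) \<noteq> 0" by (auto simp: arcs_def)
  have "A $$ (j, i) = cnj (A $$ (i, j))" by (rule hermitian_entry[OF A ij(1,2)])
  then show "(j, i) \<in> arcs {0..<m} (entries A)" using ij by (simp add: arcs_def)
qed

text \<open>
  The set of vertices reached from \<open>x\<close> is never left along nonzero entries.
\<close>
lemma irreducible_connected:
  assumes A: "A \<in> carrier_mat m m" "irreducible_mat A" and x: "x < m" and y: "y < m"
  shows "(x, y) \<in> (arcs {0..<m} (entries A))\<^sup>*"
proof (rule ccontr)
  let ?E = "arcs {0..<m} (entries A)"
  assume no: "(x, y) \<notin> ?E\<^sup>*"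
  let ?U = "{z \<in> {0..<m}. (x, z) \<in> ?E\<^sup>*}"
  have "A $$ (i, j) = 0" if "i \<in> ?U" "j \<in> {0..<m} - ?U" for i j
  proof (rule ccontr)
    assume "A $$ (i, j) \<noteq> 0"
    then have "(i, j) \<in> ?E" using that by (simp add: arcs_def)
    moreover have "(x, i) \<in> ?E\<^sup>*" using that by simp
    ultimately have "(x, j) \<in> ?E\<^sup>*" by (rule rtrancl_into_rtrancl[rotated])
    then show False using that by simp
  qed
  then have zero: "\<forall>i\<in>?U. \<forall>j\<in>{0..<m} - ?U. A $$ (i, j) = 0" by (intro ballI)
  have "x \<in> ?U" using x by simp
  then have ne: "?U \<noteq> {}" by (metis empty_iff)
  have "y \<in> {0..<m}" "y \<notin> ?U" using y no by simp_all
  then have sub: "?U \<subset> {0..<m}" by (metis (no_types, lifting) mem_Collect_eq psubsetI subsetI)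
  have "reducible_mat A" unfolding reducible_iff[OF A(1)]
    by (intro exI[of _ ?U] conjI ne sub zero)
  then show False using A(2) by (simp add: irreducible_mat_def)
qed

lemma irreducible_same_support:
  assumes A: "A \<in> carrier_mat m m" "irreducible_mat A" and B: "B \<in> carrier_mat m m"
    and supp: "\<And>i j. i < m \<Longrightarrow> j < m \<Longrightarrow> B $$ (i, j) = 0 \<longleftrightarrow> A $$ (i, j) = 0"
  shows "irreducible_mat B"
proof -
  have "reducible_mat A" if "reducible_mat B"
  proof -
    obtain U where U: "U \<noteq> {}" "U \<subset> {0..<m}" "\<forall>i\<in>U. \<forall>j\<in>{0..<m} - U. B $$ (i, j) = 0"
      using \<open>reducible_mat B\<close> reducible_iff[OF B] by auto
    have "\<forall>i\<in>U. \<forall>j\<in>{0..<m} - U. A $$ (i, j) = 0"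
    proof (intro ballI)
      fix i j assume ij: "i \<in> U" "j \<in> {0..<m} - U"
      then have "i < m" "j < m" using U(2) by auto
      then show "A $$ (i, j) = 0" using supp[of i j] U(3) ij by blast
    qed
    then show ?thesis using U reducible_iff[OF A(1)] by blast
  qed
  then show ?thesis using A B by (auto simp: irreducible_mat_def)
qed

lemma cnj_eqI:
  fixes z w :: complex
  assumes "cmod z = cmod w" "z * w = of_real (cmod (z * w))"
  shows "w = cnj z"
proof (cases "z = 0")
  case False
  have "z * w = of_real ((cmod z)\<^sup>2)"
    using assms(2) by (simp only: norm_mult assms(1)[symmetric] power2_eq_square)
  also have "\<dots> = z * cnj z" by (rule complex_norm_square)
  finally have "z * w = z * cnj z" .
  then show ?thesis using False by simp
next
  case True
  then show ?thesis using assms(1) by simp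
qed

text \<open>
  Connectedness of the graph of \<open>A\<close> closes every arc of \<open>B\<close> to a closed walk, so \<open>B\<close> has the support
  of \<open>A\<close>.  The matrix \<open>H\<close> is \<open>B\<close> conjugated by the square roots of the potential.
\<close>
lemma fiber_of_irreducible:
  assumes A: "A \<in> carrier_mat m m" "hermitian_mat A" "irreducible_mat A" and m: "0 < m"
    and BA: "B \<in> fiber A"
  shows "irreducible_mat B \<and> (\<exists>H. irreducible_mat H \<and> hermitian_mat H \<and> diag_equiv B H)"
proof -
  interpret hermitian_minors "{0..<m}" "entries A" "entries B"
    using fiber_hermitian_minors[OF A(1,2) BA] .
  have B: "B \<in> carrier_mat m m" using BA fiber_iff[OF A(1)] by simp
  have conn: "(x, y) \<in> (arcs {0..<m} (entries A))\<^sup>*" if "x < m" "y < m" for x y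
    using irreducible_connected[OF A(1,3) that] .
  have supp: "B $$ (i, j) = 0 \<longleftrightarrow> A $$ (i, j) = 0" if ij: "i < m" "j < m" for i j
  proof
    assume "A $$ (i, j) = 0"
    then have "(i, j) \<notin> arcs {0..<m} (entries A)" by (simp add: arcs_def)
    moreover have "(j, i) \<in> (arcs {0..<m} (entries B))\<^sup>*"
      using conn[OF ij(2,1)] rtrancl_mono[OF arcs_subset] by blast
    ultimately have "(i, j) \<notin> arcs {0..<m} (entries B)" using arc_returns by blast
    then show "B $$ (i, j) = 0" using ij by (simp add: arcs_def)
  next
    assume "B $$ (i, j) = 0"
    then show "A $$ (i, j) = 0" using A_zero_iff[of i j] ij by simp
  qed
  have "0 \<in> {0..<m}" using m by simp
  then have "\<exists>\<phi>. (\<forall>x\<in>{0..<m}. \<phi> x > (0::real)) \<and>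
      (\<forall>x\<in>{0..<m}. \<forall>y\<in>{0..<m}. cmod (entries B x y) * \<phi> x = cmod (entries B y x) * \<phi> y)"
    by (rule potential) (use conn m in simp)
  then obtain \<phi> where "\<forall>x\<in>{0..<m}. \<phi> x > (0::real)"
    "\<forall>x\<in>{0..<m}. \<forall>y\<in>{0..<m}. cmod (entries B x y) * \<phi> x = cmod (entries B y x) * \<phi> y" by blast
  then have pos: "x < m \<Longrightarrow> \<phi> x > 0"
    and bal: "x < m \<Longrightarrow> y < m \<Longrightarrow> cmod (B $$ (x, y)) * \<phi> x = cmod (B $$ (y, x)) * \<phi> y" for x y
    by simp_all
  define \<psi> where "\<psi> x = sqrt (\<phi> x)" for x
  have psi: "\<psi> x > 0" "\<psi> x * \<psi> x = \<phi> x" if "x < m" for x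
    using pos[OF that] by (simp_all add: \<psi>_def)
  define H where "H = mat m m (\<lambda>(i, j). B $$ (i, j) * of_real (\<psi> i / \<psi> j))"
  have H: "H \<in> carrier_mat m m" by (simp add: H_def)
  have He: "H $$ (i, j) = B $$ (i, j) * of_real (\<psi> i / \<psi> j)" if "i < m" "j < m" for i j
    using that by (simp add: H_def)
  have "irreducible_mat B" by (rule irreducible_same_support[OF A(1,3) B supp])
  moreover have "irreducible_mat H"
    by (rule irreducible_same_support[OF A(1,3) H]) (use supp psi(1) in \<open>force simp: He\<close>)
  moreover have "hermitian_mat H"
    unfolding hermitian_mat_iff[OF H]
  proof (intro allI impI)
    fix i j assume ij: "i < m" "j < m"
    have "H $$ (j, i) = cnj (H $$ (i, j))"
    proof (rule cnj_eqI)
      have p: "\<psi> i > 0" "\<psi> j > 0" using psi ij by auto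
      have "cmod (B $$ (i, j)) * (\<psi> i * \<psi> i) = cmod (B $$ (j, i)) * (\<psi> j * \<psi> j)"
        using bal[OF ij] psi ij by simp
      then have "cmod (B $$ (i, j)) * (\<psi> i / \<psi> j) = cmod (B $$ (j, i)) * (\<psi> j / \<psi> i)"
        using p by (simp add: field_simps)
      then show "cmod (H $$ (i, j)) = cmod (H $$ (j, i))"
        using p ij by (simp add: He norm_mult norm_divide)
      have "H $$ (i, j) * H $$ (j, i) = B $$ (i, j) * B $$ (j, i)"
        using p ij by (simp add: He field_simps)
      also have "\<dots> = A $$ (i, j) * A $$ (j, i)" using prod_eq ij by simp
      also have "A $$ (j, i) = cnj (A $$ (i, j))" using herm[of i j] ij by simp
      also have "A $$ (i, j) * cnj (A $$ (i, j)) = of_real ((cmod (A $$ (i, j)))\<^sup>2)"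
        by (rule complex_norm_square[symmetric])
      finally have HH: "H $$ (i, j) * H $$ (j, i) = of_real ((cmod (A $$ (i, j)))\<^sup>2)" .
      show "H $$ (i, j) * H $$ (j, i) = of_real (cmod (H $$ (i, j) * H $$ (j, i)))"
        by (simp only: HH norm_of_real abs_power2)
    qed
    then show "cnj (H $$ (j, i)) = H $$ (i, j)" by simp
  qed
  moreover have "diag_equiv B H"
  proof -
    define D where "D = mat_diag m (\<lambda>i. complex_of_real (1 / \<psi> i))"
    define D' where "D' = mat_diag m (\<lambda>i. complex_of_real (\<psi> i))"
    have D: "D \<in> carrier_mat m m" "D' \<in> carrier_mat m m" by (simp_all add: D_def D'_def)
    have pnz: "\<psi> i \<noteq> 0" if "i < m" for i using psi(1)[OF that] by simp
    have "D * D' = 1\<^sub>m m" "D' * D = 1\<^sub>m m"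
      unfolding D_def D'_def mat_diag_diag
      by (rule eq_matI; use pnz in \<open>auto simp: mat_diag_def\<close>)+
    then have "inverts_mat D D'" "inverts_mat D' D" using D by (auto simp: inverts_mat_def)
    moreover have "diagonal_mat D" by (simp add: diagonal_mat_def D_def mat_diag_def)
    moreover have "B = D * H * D'"
    proof (rule eq_matI)
      fix i j assume "i < dim_row (D * H * D')" "j < dim_col (D * H * D')"
      then have ij: "i < m" "j < m" using D H by auto
      have "(D * H * D') $$ (i, j) = of_real (1 / \<psi> i) * H $$ (i, j) * of_real (\<psi> j)"
        unfolding D_def D'_def using H ij
        by (simp add: mat_diag_mult_left[OF H] mat_diag_mult_right[of _ m m])
      then show "B $$ (i, j) = (D * H * D') $$ (i, j)" using ij pnz by (simp add: He)
    qed (use B D H in auto)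
    ultimately show ?thesis unfolding diag_equiv_def using B H D
      by (intro exI[of _ m] exI[of _ D] exI[of _ D']) auto
  qed
  ultimately show ?thesis by blast
qed

section \<open>The fiber of a reducible Hermitian matrix\<close>

lemma sorting_permutation:
  fixes f :: "nat \<Rightarrow> nat"
  shows "\<exists>\<pi>. \<pi> permutes {0..<s} \<and> (\<forall>j<s. \<forall>i<j. f (\<pi> i) \<le> f (\<pi> j))"
proof -
  let ?L = "sort_key f [0..<s]"
  let ?\<pi> = "\<lambda>i. if i < s then ?L ! i else i"
  have L: "length ?L = s" "distinct ?L" "set ?L = {0..<s}" by auto
  have "bij_betw (\<lambda>i. ?L ! i) {0..<s} {0..<s}"
    by (rule bij_betw_nth) (use L in \<open>auto simp: atLeast0LessThan\<close>)
  then have "bij_betw ?\<pi> {0..<s} {0..<s}"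
    by (subst bij_betw_cong[where g = "\<lambda>i. ?L ! i"]) auto
  then have "?\<pi> permutes {0..<s}" by (rule bij_imp_permutes) auto
  moreover have "f (?\<pi> i) \<le> f (?\<pi> j)" if "j < s" "i < j" for i j
  proof -
    have "map f ?L ! i \<le> map f ?L ! j"
      by (rule sorted_nth_mono) (use that L(1) in auto)
    then show ?thesis using that L(1) by simp
  qed
  ultimately show ?thesis by blast
qed

lemma UN_permutes:
  fixes s :: nat
  assumes "\<pi> permutes {0..<s}"
  shows "(\<Union>k<s. T (\<pi> k)) = (\<Union>k<s. T k)"
proof -
  have "(\<Union>k\<in>{0..<s}. T (\<pi> k)) = (\<Union>k\<in>\<pi> ` {0..<s}. T k)" by blast
  then show ?thesis by (simp only: permutes_image[OF assms] lessThan_atLeast0)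
qed

lemma reducible_submatrix:
  assumes M: "M \<in> carrier_mat n n" and T: "T \<subseteq> {0..<n}"
    and red: "reducible_mat (submatrix M T T)"
  shows "\<exists>U. U \<noteq> {} \<and> U \<subset> T \<and> (\<forall>i\<in>U. \<forall>j\<in>T - U. M $$ (i, j) = 0)"
proof -
  have bij: "bij_betw (pick T) {0..<card T} T"
    using bij_betw_pick T finite_subset by blast
  then have inj: "inj_on (pick T) {0..<card T}" and im: "pick T ` {0..<card T} = T"
    by (auto simp: bij_betw_def)
  note c = submatrix_carrier[OF M T T]
  obtain W where W: "W \<noteq> {}" "W \<subset> {0..<card T}"
      "\<forall>i\<in>W. \<forall>j\<in>{0..<card T} - W. submatrix M T T $$ (i, j) = 0"
    using red reducible_iff[OF c(1)] by blast
  let ?U = "pick T ` W"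
  have "pick T ` ({0..<card T} - W) = pick T ` {0..<card T} - ?U"
    by (rule inj_on_image_set_diff[OF inj]) (use W(2) in auto)
  then have compl: "pick T ` ({0..<card T} - W) = T - ?U" by (simp only: im)
  have entry: "M $$ (pick T a, pick T b) = 0" if ab: "a \<in> W" "b \<in> {0..<card T} - W" for a b
  proof -
    have "a < card T" "b < card T" using ab W(2) by auto
    then have "submatrix M T T $$ (a, b) = M $$ (pick T a, pick T b)" by (rule c(2))
    then show ?thesis using W(3) ab by force
  qed
  have zero: "\<forall>i\<in>?U. \<forall>j\<in>T - ?U. M $$ (i, j) = 0"
    unfolding compl[symmetric] using entry by blast
  have ne: "?U \<noteq> {}" using W(1) by simp
  have "?U \<subseteq> T" using W(2) im by blast
  moreover have "?U \<noteq> T" using W(2) im inj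
    by (metis inj_on_image_eq_iff order_refl psubset_eq)
  ultimately have sub: "?U \<subset> T" by simp
  show ?thesis by (intro exI[of _ ?U] conjI ne sub zero)
qed

lemma hermitian_submatrix:
  assumes M: "M \<in> carrier_mat n n" "hermitian_mat M" and T: "T \<subseteq> {0..<n}"
  shows "hermitian_mat (submatrix M T T)"
  unfolding hermitian_mat_iff[OF submatrix_carrier(1)[OF M(1) T T]]
proof (intro allI impI)
  fix i j assume ij: "i < card T" "j < card T"
  have "pick T i < n" "pick T j < n" using pick_in_set_le[OF ij(1)] pick_in_set_le[OF ij(2)] T by auto
  then show "cnj (submatrix M T T $$ (j, i)) = submatrix M T T $$ (i, j)"
    using hermitian_mat_iff[OF M(1)] M(2) submatrix_carrier(2)[OF M(1) T T] ij by simp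
qed

lemma block_triangularizable_zero:
  assumes B: "B \<in> carrier_mat n n" and bt: "block_triangularizable_with s T B"
  obtains \<pi> where "\<pi> permutes {0..<s}"
    "\<And>k l i j. k < s \<Longrightarrow> l < k \<Longrightarrow> i \<in> T (\<pi> k) \<Longrightarrow> j \<in> T (\<pi> l) \<Longrightarrow> B $$ (i, j) = 0"
proof -
  from bt obtain p \<pi> where p: "p permutes {0..<n}" and \<pi>: "\<pi> permutes {0..<s}"
    and but: "block_upper_triangular (map (\<lambda>k. card (T (\<pi> k))) [0..<s]) (permute_mat p B)"
    and im: "\<And>k. k < s \<Longrightarrow> p ` block_inds (map (\<lambda>k. card (T (\<pi> k))) [0..<s]) k = T (\<pi> k)"
    using B unfolding block_triangularizable_with_def Let_def by auto
  let ?ds = "map (\<lambda>k. card (T (\<pi> k))) [0..<s]"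
  have n: "sum_list ?ds = n" using but B by (auto simp: block_upper_triangular_def permute_mat_def)
  have "B $$ (i, j) = 0" if kl: "k < s" "l < k" "i \<in> T (\<pi> k)" "j \<in> T (\<pi> l)" for k l i j
  proof -
    have ls: "l < s" using kl by simp
    obtain i' where i': "i' \<in> block_inds ?ds k" "i = p i'" using im[OF kl(1)] kl(3) by blast
    obtain j' where j': "j' \<in> block_inds ?ds l" "j = p j'" using im[OF ls] kl(4) by blast
    have "i' < n" using subsetD[OF block_inds_sub i'(1)] unfolding n by simp
    moreover have "j' < n" using subsetD[OF block_inds_sub j'(1)] unfolding n by simp
    ultimately have "permute_mat p B $$ (i', j') = B $$ (i, j)" using B i' j' by (simp add: permute_mat_def)
    moreover have "permute_mat p B $$ (i', j') = 0"
      by (rule block_upper_triangularD[OF but _ kl(2) i'(1) j'(1)]) (use kl in simp)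
    ultimately show ?thesis by simp
  qed
  with \<pi> show thesis using that by blast
qed

definition component :: "nat set \<Rightarrow> (nat \<Rightarrow> nat \<Rightarrow> 'a::zero) \<Rightarrow> nat \<Rightarrow> nat set" where
  "component V M x = {y \<in> V. (x, y) \<in> (arcs V M)\<^sup>*}"

locale reducible_hermitian =
  fixes n :: nat and A :: "complex mat"
  assumes A: "A \<in> carrier_mat n n" "hermitian_mat A" and red: "reducible_mat A"
begin

abbreviation (input) V where "V \<equiv> {0..<n}"
abbreviation (input) E where "E \<equiv> arcs V (entries A)"
abbreviation (input) comp where "comp \<equiv> component V (entries A)"

lemma sym_E: "(x, y) \<in> E\<^sup>* \<Longrightarrow> (y, x) \<in> E\<^sup>*"
  using sym_rtrancl[OF sym_arcs_hermitian[OF A]] by (rule symD)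

lemma comp_self: "x \<in> V \<Longrightarrow> x \<in> comp x"
  by (simp add: component_def)

lemma comp_eq: "y \<in> comp x \<Longrightarrow> comp y = comp x"
  unfolding component_def using sym_E by (auto intro: rtrancl_trans)

lemma comp_closed: "x \<in> comp r \<Longrightarrow> y \<in> V \<Longrightarrow> A $$ (x, y) \<noteq> 0 \<Longrightarrow> y \<in> comp r"
  unfolding component_def by (auto intro: rtrancl_into_rtrancl simp: arcs_def)

lemma closed_reach:
  assumes "(x, y) \<in> E\<^sup>*" "x \<in> U" "\<And>i j. i \<in> U \<Longrightarrow> j \<in> V - U \<Longrightarrow> A $$ (i, j) = 0"
  shows "y \<in> U"
  using assms(1,2)
proof (induction rule: rtrancl_induct)
  case (step y z)
  then show ?case using assms(3)[of y z] by (auto simp: arcs_def)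
qed

lemma comp_irreducible:
  assumes r: "r \<in> V"
  shows "irreducible_mat (submatrix A (comp r) (comp r))"
proof -
  have sub: "comp r \<subseteq> V" by (auto simp: component_def)
  have "\<not> reducible_mat (submatrix A (comp r) (comp r))"
  proof
    assume "reducible_mat (submatrix A (comp r) (comp r))"
    from reducible_submatrix[OF A(1) sub this] obtain U where U: "U \<noteq> {}" "U \<subset> comp r"
      "\<And>i j. i \<in> U \<Longrightarrow> j \<in> comp r - U \<Longrightarrow> A $$ (i, j) = 0" by blast
    obtain x where x: "x \<in> U" using U(1) by blast
    then have xr: "x \<in> comp r" using U(2) by blast
    have "y \<in> U" if "y \<in> comp r" for y
    proof (rule closed_reach[OF _ x])
      show "(x, y) \<in> E\<^sup>*" using comp_eq[OF xr] that by (auto simp: component_def)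
      show "A $$ (i, j) = 0" if ij: "i \<in> U" "j \<in> V - U" for i j
      proof (cases "j \<in> comp r")
        case True
        then show ?thesis using U(3) ij by blast
      next
        case False
        have "i \<in> comp r" using ij(1) U(2) by blast
        then show ?thesis using comp_closed[of i r j] False ij(2) by blast
      qed
    qed
    then show False using U(2) by blast
  qed
  then show ?thesis
    using submatrix_carrier(1)[OF A(1) sub sub] by (auto simp: irreducible_mat_def)
qed

lemma component_enumeration:
  obtains s :: nat and T where "s \<ge> 2" "(\<Union>k<s. T k) = V" "disjoint_family_on T {..<s}"
    "\<forall>k<s. T k \<noteq> {}" "\<forall>k<s. \<forall>x\<in>T k. T k = comp x"
proof -
  let ?C = "comp ` V"
  obtain h where h: "bij_betw h {0..<card ?C} ?C"
    using ex_bij_betw_nat_finite[of ?C] by auto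
  have hk: "\<exists>r\<in>V. h k = comp r" if "k < card ?C" for k
    using bij_betw_apply[OF h, of k] that by auto
  have eq: "h k = comp x" if k: "k < card ?C" and x: "x \<in> h k" for k x
  proof -
    obtain r where "h k = comp r" using hk[OF k] by blast
    then show ?thesis using comp_eq[of x r] x by simp
  qed
  obtain U where U: "U \<noteq> {}" "U \<subset> V" "\<And>i j. i \<in> U \<Longrightarrow> j \<in> V - U \<Longrightarrow> A $$ (i, j) = 0"
    using red reducible_iff[OF A(1)] by blast
  show thesis
  proof (rule that)
    obtain x y where xy: "x \<in> U" "y \<in> V - U" using U(1,2) by blast
    have "y \<notin> comp x" using closed_reach[of x y U, OF _ xy(1) U(3)] xy(2) by (auto simp: component_def)
    then have ne: "comp x \<noteq> comp y" using comp_self[of y] xy(2) by blast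
    have "{comp x, comp y} \<subseteq> ?C" using xy U(2) by blast
    then have "card {comp x, comp y} \<le> card ?C" by (intro card_mono) auto
    then show "2 \<le> card ?C" using ne by simp
    have "(\<Union>k<card ?C. h k) = \<Union> ?C"
      using h by (simp add: bij_betw_def lessThan_atLeast0)
    also have "\<Union> ?C = V" using comp_self by (auto simp: component_def)
    finally show "(\<Union>k<card ?C. h k) = V" .
    show "disjoint_family_on h {..<card ?C}"
      unfolding disjoint_family_on_def
    proof (intro ballI impI equals0I)
      fix k l x assume kl: "k \<in> {..<card ?C}" "l \<in> {..<card ?C}" "k \<noteq> l" and x: "x \<in> h k \<inter> h l"
      have "h k = h l" using eq[of k x] eq[of l x] kl x by simp
      then have "k = l"
        by (rule inj_onD[OF bij_betw_imp_inj_on[OF h]]) (use kl in auto)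
      then show False using kl(3) by simp
    qed
    show "\<forall>k<card ?C. h k \<noteq> {}" using hk comp_self by blast
    show "\<forall>k<card ?C. \<forall>x\<in>h k. h k = comp x" using eq by (intro allI impI ballI)
  qed
qed

end

locale hermitian_components = reducible_hermitian +
  fixes s :: nat and T :: "nat \<Rightarrow> nat set"
  assumes Tunion: "(\<Union>k<s. T k) = {0..<n}" and Tdisj: "disjoint_family_on T {..<s}"
    and Tne: "\<And>k. k < s \<Longrightarrow> T k \<noteq> {}"
    and Tcomp: "\<And>k x. k < s \<Longrightarrow> x \<in> T k \<Longrightarrow> T k = component {0..<n} (entries A) x"
begin

sublocale index_partition n s T
  using Tunion Tdisj by unfold_locales

lemma T_connected: "k < s \<Longrightarrow> x \<in> T k \<Longrightarrow> y \<in> T k \<Longrightarrow> (x, y) \<in> E\<^sup>*"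
  using Tcomp[of k x] by (auto simp: component_def)

lemma T_off:
  assumes "k < s" "l < s" "k \<noteq> l" "x \<in> T k" "y \<in> T l"
  shows "A $$ (x, y) = 0"
proof (rule ccontr)
  assume "A $$ (x, y) \<noteq> 0"
  moreover have "x \<in> comp x" using Tcomp[OF assms(1,4)] assms(4) by simp
  moreover have "y \<in> V" using T_sub[OF assms(2)] assms(5) by blast
  ultimately have "y \<in> comp x" using comp_closed[of x x y] by blast
  then have "y \<in> T k" using Tcomp[of k x] assms by simp
  then show False using disjoint_family_onD[OF Tdisj, of k l] assms by auto
qed

lemma T_irreducible: "k < s \<Longrightarrow> irreducible_mat (submatrix A (T k) (T k))"
proof -
  assume k: "k < s"
  obtain x where x: "x \<in> T k" using Tne[OF k] by blast
  then have "T k = comp x" "x \<in> V" using Tcomp[OF k] T_sub[OF k] by auto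
  then show ?thesis using comp_irreducible by simp
qed

lemma A_completely_reducible: "completely_reducible_mat A"
proof -
  let ?Bs = "map (\<lambda>k. submatrix A (T k) (T k)) [0..<s]"
  have "permute_mat (layout T s) A = diag_block_mat ?Bs"
    by (rule layout_diagonal[OF A(1)]) (rule T_off)
  moreover have "dim_row (submatrix A (T k) (T k)) > 0" if "k < s" for k
    using submatrix_carrier(1)[OF A(1) T_sub[OF that] T_sub[OF that]] Tne[OF that] T_fin[OF that]
    by (auto simp: card_gt_0_iff)
  ultimately show ?thesis unfolding completely_reducible_mat_def
    using layout_permutes T_irreducible A(1)
    by (intro exI[of _ "layout T s"] exI[of _ ?Bs]) auto
qed

lemma factor_dvd:
  assumes k: "k < s"
  shows "det_poly (T k) (submatrix A (T k) (T k)) dvd det_poly V A"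
proof -
  have "det_poly V A = minor (pencil A) V"
    using det_poly_minor[OF A(1) order_refl] submatrix_full[OF A(1)] by simp
  also have "\<dots> = (\<Prod>k<s. minor (pencil A) (T k))"
    unfolding union[symmetric]
  proof (rule minor_UNION)
    fix k l i j assume kl: "k < s" "l < k" "i \<in> T k" "j \<in> T l"
    then have "i \<noteq> j" using disjoint_family_onD[OF Tdisj, of k l] by auto
    moreover have "A $$ (i, j) = 0" by (rule T_off[of k l]) (use kl in auto)
    ultimately show "pencil A i j = 0" by (simp add: pencil_def Const_hom)
  qed (use T_fin Tdisj in auto)
  finally show ?thesis
    unfolding det_poly_minor[OF A(1) T_sub[OF k]] using k by (auto intro: dvd_prodI)
qed

text \<open>
  An arc of \<open>B\<close> from one component to another makes the set of vertices reached strictly smaller: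
  the source cannot be reached again, by \<open>arc_returns\<close>.  Sorting by the size of these sets
  therefore orders the components topologically.
\<close>
lemma fiber_triangularizable:
  assumes BA: "B \<in> fiber A"
  shows "block_triangularizable_with s T B"
proof -
  interpret hermitian_minors V "entries A" "entries B"
    using fiber_hermitian_minors[OF A BA] .
  have B: "B \<in> carrier_mat n n" using BA fiber_iff[OF A(1)] by simp
  let ?D = "arcs V (entries B)"
  have ED: "E\<^sup>* \<subseteq> ?D\<^sup>*" by (rule rtrancl_mono[OF arcs_subset])
  define R where "R k = {y \<in> V. \<exists>x\<in>T k. (x, y) \<in> ?D\<^sup>*}" for k
  have R_less: "card (R l) < card (R k)" "card (R k) \<le> n"
    if kl: "k < s" "l < s" "k \<noteq> l" "i \<in> T k" "j \<in> T l" "B $$ (i, j) \<noteq> 0" for k l i j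
  proof -
    have V: "i \<in> V" "j \<in> V" using kl T_sub by blast+
    then have arc: "(i, j) \<in> ?D" using kl(6) by (simp add: arcs_def)
    have reach: "(j, x) \<in> ?D\<^sup>*" if "x \<in> T l" for x
      using T_connected[OF kl(2) kl(5) that] ED by blast
    have "R l \<subseteq> R k"
    proof
      fix y assume "y \<in> R l"
      then obtain x where x: "y \<in> V" "x \<in> T l" "(x, y) \<in> ?D\<^sup>*" by (auto simp: R_def)
      have "(i, y) \<in> ?D\<^sup>*" using arc reach[OF x(2)] x(3)
        by (meson converse_rtrancl_into_rtrancl rtrancl_trans)
      then show "y \<in> R k" using x(1) kl(4) by (auto simp: R_def)
    qed
    moreover have "i \<in> R k" using V kl(4) by (auto simp: R_def)
    moreover have "i \<notin> R l"
    proof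
      assume "i \<in> R l"
      then obtain x where x: "x \<in> T l" "(x, i) \<in> ?D\<^sup>*" by (auto simp: R_def)
      have "(j, i) \<in> ?D\<^sup>*" using reach[OF x(1)] x(2) by (rule rtrancl_trans)
      then have "(i, j) \<in> E" using arc_returns[OF arc] by blast
      then show False using T_off[OF kl(1-5)] by (simp add: arcs_def)
    qed
    moreover have "finite (R k)" by (simp add: R_def)
    ultimately show "card (R l) < card (R k)" by (intro psubset_card_mono) auto
    have "R k \<subseteq> V" by (auto simp: R_def)
    then show "card (R k) \<le> n" using card_mono[of V "R k"] by simp
  qed
  \<comment> \<open>The subtraction reverses the order: components that reach more come first.\<close>
  obtain \<pi> where \<pi>: "\<pi> permutes {0..<s}"
    and sorted: "\<forall>j<s. \<forall>i<j. n - card (R (\<pi> i)) \<le> n - card (R (\<pi> j))"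
    using sorting_permutation[of s "\<lambda>k. n - card (R k)"] by blast
  have \<pi>s: "\<pi> k < s \<longleftrightarrow> k < s" for k using permutes_in_image[OF \<pi>, of k] by simp
  have \<pi>inj: "\<pi> k = \<pi> l \<longleftrightarrow> k = l" for k l using permutes_inj[OF \<pi>] by (auto dest: injD)
  let ?T = "\<lambda>k. T (\<pi> k)"
  interpret P: index_partition n s ?T
  proof
    show "(\<Union>k<s. ?T k) = {0..<n}"
      unfolding UN_permutes[OF \<pi>] by (rule union)
    show "disjoint_family_on ?T {..<s}"
      unfolding disjoint_family_on_def
      using disjoint_family_onD[OF Tdisj] by (simp add: \<pi>s \<pi>inj)
  qed
  have "block_upper_triangular P.ds (permute_mat (layout ?T s) B)"
  proof (rule P.layout_triangular[OF B])
    show "?T k \<noteq> {}" if "k < s" for k using Tne that by (simp add: \<pi>s)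
    fix k l i j assume kl: "k < s" "l < k" "i \<in> ?T k" "j \<in> ?T l"
    show "B $$ (i, j) = 0"
    proof (rule ccontr)
      assume "B $$ (i, j) \<noteq> 0"
      then have "card (R (\<pi> l)) < card (R (\<pi> k))" "card (R (\<pi> k)) \<le> n"
        using R_less[of "\<pi> k" "\<pi> l" i j] kl by (simp_all add: \<pi>s \<pi>inj)
      moreover have "n - card (R (\<pi> l)) \<le> n - card (R (\<pi> k))" using sorted kl by blast
      ultimately show False by linarith
    qed
  qed
  then show ?thesis
    unfolding block_triangularizable_with_def Let_def
    using P.layout_permutes \<pi> B P.layout_block P.submatrix_layout[OF B]
    by (intro exI[of _ "layout ?T s"] exI[of _ \<pi>]) auto
qed

text \<open>
  The principal minors of \<open>B\<close> and of \<open>A\<close> factor over the same sets \<open>S \<inter> T i\<close>, and the factors are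
  coefficients of the determinantal polynomials of the blocks.
\<close>
lemma triangularizable_fiber:
  assumes B: "B \<in> carrier_mat n n" and bt: "block_triangularizable_with s T B"
    and eq: "\<And>k. k < s \<Longrightarrow> det_poly (T k) (submatrix B (T k) (T k)) = det_poly (T k) (submatrix A (T k) (T k))"
  shows "B \<in> fiber A"
  unfolding fiber_iff[OF A(1)]
proof (intro conjI allI impI)
  show "B \<in> carrier_mat n n" by (rule B)
  fix S assume S: "S \<subseteq> {0..<n}"
  obtain \<pi> where \<pi>: "\<pi> permutes {0..<s}"
    and zero: "\<And>k l i j. k < s \<Longrightarrow> l < k \<Longrightarrow> i \<in> T (\<pi> k) \<Longrightarrow> j \<in> T (\<pi> l) \<Longrightarrow> B $$ (i, j) = 0"
    using block_triangularizable_zero[OF B bt] by blast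
  have \<pi>s: "\<pi> k < s \<longleftrightarrow> k < s" for k using permutes_in_image[OF \<pi>, of k] by simp
  have \<pi>inj: "\<pi> k = \<pi> l \<longleftrightarrow> k = l" for k l using permutes_inj[OF \<pi>] by (auto dest: injD)
  let ?S = "\<lambda>k. S \<inter> T (\<pi> k)"
  have "(\<Union>k<s. T (\<pi> k)) = {0..<n}"
    unfolding UN_permutes[OF \<pi>] by (rule union)
  then have SU: "S = (\<Union>k<s. ?S k)" using S by blast
  have Sdisj: "disjoint_family_on ?S {..<s}"
    unfolding disjoint_family_on_def
  proof (intro ballI impI)
    fix k l assume "k \<in> {..<s}" "l \<in> {..<s}" "k \<noteq> l"
    then have "T (\<pi> k) \<inter> T (\<pi> l) = {}"
      using disjoint_family_onD[OF Tdisj, of "\<pi> k" "\<pi> l"] by (simp add: \<pi>s \<pi>inj)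
    then show "?S k \<inter> ?S l = {}" by blast
  qed
  have Sfin: "finite (?S k)" if "k < s" for k using S finite_subset by blast
  have "minor (entries B) (\<Union>k<s. ?S k) = (\<Prod>k<s. minor (entries B) (?S k))"
    by (rule minor_UNION[OF Sfin Sdisj]) (use zero in auto)
  also have "\<dots> = (\<Prod>k<s. minor (entries A) (?S k))"
  proof (rule prod.cong[OF refl])
    fix k assume "k \<in> {..<s}"
    then have k: "\<pi> k < s" by (simp add: \<pi>s)
    have "minor (pencil B) (T (\<pi> k)) = minor (pencil A) (T (\<pi> k))"
      using eq[OF k] det_poly_minor[OF B T_sub[OF k]] det_poly_minor[OF A(1) T_sub[OF k]] by simp
    then show "minor (entries B) (?S k) = minor (entries A) (?S k)"
      using minor_pencil_eq_iff[OF T_fin[OF k], of B A] by blast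
  qed
  also have "\<dots> = minor (entries A) (\<Union>k<s. ?S k)"
  proof (rule minor_UNION[OF Sfin Sdisj, symmetric])
    fix k l i j assume kl: "k < s" "l < k" "i \<in> ?S k" "j \<in> ?S l"
    show "A $$ (i, j) = 0"
      by (rule T_off[of "\<pi> k" "\<pi> l"]) (use kl in \<open>auto simp: \<pi>s \<pi>inj\<close>)
  qed
  finally show "minor (entries B) S = minor (entries A) S" unfolding SU[symmetric] .
qed

lemma fiber_blocks:
  assumes BA: "B \<in> fiber A" and k: "k < s"
  shows "irreducible_mat (submatrix B (T k) (T k)) \<and>
      (\<exists>H. irreducible_mat H \<and> hermitian_mat H \<and> diag_equiv (submatrix B (T k) (T k)) H) \<and>
      det_poly (T k) (submatrix B (T k) (T k)) = det_poly (T k) (submatrix A (T k) (T k))"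
proof -
  have B: "B \<in> carrier_mat n n" and m: "\<And>S. S \<subseteq> V \<Longrightarrow> minor (entries B) S = minor (entries A) S"
    using BA fiber_iff[OF A(1)] by auto
  note Tk = T_sub[OF k]
  have m': "\<forall>S\<subseteq>T k. minor (entries B) S = minor (entries A) S"
    using m Tk by (meson subset_trans)
  have "0 < card (T k)" using Tne[OF k] T_fin[OF k] by (simp add: card_gt_0_iff)
  moreover have "submatrix B (T k) (T k) \<in> fiber (submatrix A (T k) (T k))"
    using fiber_submatrix[OF A(1) B Tk] m' by blast
  ultimately have "irreducible_mat (submatrix B (T k) (T k)) \<and>
      (\<exists>H. irreducible_mat H \<and> hermitian_mat H \<and> diag_equiv (submatrix B (T k) (T k)) H)"
    using fiber_of_irreducible[OF submatrix_carrier(1)[OF A(1) Tk Tk]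
      hermitian_submatrix[OF A Tk] T_irreducible[OF k]] by blast
  moreover have "det_poly (T k) (submatrix B (T k) (T k)) = det_poly (T k) (submatrix A (T k) (T k))"
    unfolding det_poly_minor[OF B Tk] det_poly_minor[OF A(1) Tk]
    using minor_pencil_eq_iff[OF T_fin[OF k]] m' by blast
  ultimately show ?thesis by blast
qed

end

section \<open>The classification of the fiber\<close>

theorem mainTheorem3:
  fixes n :: nat and A :: "complex mat" and f :: cpoly
  assumes n: "n \<ge> 4"
    and A: "A \<in> carrier_mat n n" "hermitian_mat A"
    and f: "f = det_poly {0..<n} A"
  shows
    "(irreducible_mat A \<and>
       (\<forall>B \<in> fiber A. \<exists>H. irreducible_mat H \<and> hermitian_mat H \<and> diag_equiv B H))
     \<or>
     (completely_reducible_mat A \<and>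
       (\<exists>s T. s \<ge> 2 \<and>
          (\<Union>i<s. T i) = {0..<n} \<and> disjoint_family_on T {..<s} \<and> (\<forall>i<s. T i \<noteq> {}) \<and>
          (\<forall>i<s. \<forall>j<s. i \<noteq> j \<longrightarrow>
             submatrix A (T i) (T j) = 0\<^sub>m (card (T i)) (card (T j))) \<and>
          (\<forall>i<s. irreducible_mat (submatrix A (T i) (T i))) \<and>
          (\<forall>i<s. det_poly (T i) (submatrix A (T i) (T i)) dvd f) \<and>
          fiber A = {B \<in> carrier_mat n n.
            block_triangularizable_with s T B \<and>
            (\<forall>i<s. irreducible_mat (submatrix B (T i) (T i)) \<and>
               (\<exists>H. irreducible_mat H \<and> hermitian_mat H \<and>
                  diag_equiv (submatrix B (T i) (T i)) H) \<and>
               det_poly (T i) (submatrix B (T i) (T i))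
                 = det_poly (T i) (submatrix A (T i) (T i)))}))"
proof (cases "reducible_mat A")
  case False
  then have irr: "irreducible_mat A" using A(1) by (simp add: irreducible_mat_def)
  have "0 < n" using n by simp
  have "\<exists>H. irreducible_mat H \<and> hermitian_mat H \<and> diag_equiv B H" if "B \<in> fiber A" for B
    using fiber_of_irreducible[OF A irr \<open>0 < n\<close> that] by (rule conjunct2)
  then show ?thesis using irr by (intro disjI1 conjI ballI)
next
  case True
  interpret reducible_hermitian n A
    using A True by unfold_locales
  obtain s :: nat and T where s: "s \<ge> 2" and T: "(\<Union>k<s. T k) = {0..<n}" "disjoint_family_on T {..<s}"
    "\<forall>k<s. T k \<noteq> {}" "\<forall>k<s. \<forall>x\<in>T k. T k = component {0..<n} (entries A) x"
    by (rule component_enumeration)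
  interpret hermitian_components n A s T
    by unfold_locales (use T(3,4) in \<open>simp_all only: T(1,2)\<close>, blast+)
  have off: "submatrix A (T i) (T j) = 0\<^sub>m (card (T i)) (card (T j))" if "i < s" "j < s" "i \<noteq> j" for i j
    using submatrix_zero_iff[OF A(1) T_sub[OF that(1)] T_sub[OF that(2)]] T_off[OF that] by blast
  have fib: "fiber A = {B \<in> carrier_mat n n.
            block_triangularizable_with s T B \<and>
            (\<forall>i<s. irreducible_mat (submatrix B (T i) (T i)) \<and>
               (\<exists>H. irreducible_mat H \<and> hermitian_mat H \<and>
                  diag_equiv (submatrix B (T i) (T i)) H) \<and>
               det_poly (T i) (submatrix B (T i) (T i))
                 = det_poly (T i) (submatrix A (T i) (T i)))}" (is "_ = ?F")
  proof (intro subset_antisym subsetI)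
    fix B assume B: "B \<in> fiber A"
    then have "B \<in> carrier_mat n n" using fiber_iff[OF A(1)] by blast
    then show "B \<in> ?F" using fiber_triangularizable[OF B] fiber_blocks[OF B] by blast
  next
    fix B assume "B \<in> ?F"
    then show "B \<in> fiber A" by (intro triangularizable_fiber) blast+
  qed
  show ?thesis
    unfolding f
  proof (intro disjI2 conjI exI[of _ s] exI[of _ T] allI impI)
    show "completely_reducible_mat A" by (rule A_completely_reducible)
    show "fiber A = ?F" by (rule fib)
  qed (simp_all add: s T(1-3) off T_irreducible factor_dvd)
qed

end
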